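(* Let $\Sigma$ be a Polish space. Let $((W_i^n)_{1\le i\le n})_{n\ge1}$ be a triangular array of $\mathbb{R}_+$-valued random variables on a probability space $(\Omega,\mathcal{A},\mathbb{P})$ such that: for every $n$, $\sum_{i=1}^nW_i^n=n$; for every $n$, $(W_1^n,\dots,W_n^n)$ is exchangeable; and $\left(\frac1n\sum_{i=1}^n\delta_{W_i^n}\right)_{n\ge1}$ satisfies an LDP on $M_1^1(\mathbb{R}_+)$ endowed with the Wasserstein-1 distance with good rate function $I^W$. Then the following are equivalent: (i) for every triangular array $((X_i^n)_{1\le i\le n})_{n\ge1}$ of $\Sigma$-valued random variables such that $\left(\frac1n\sum_{i=1}^n\delta_{X_i^n}\right)_{n\ge1}$ satisfies an LDP on $M_1(\Sigma)$ endowed with the weak convergence topology with good rate function $I^X$ and such that, for every $n$, $(X_1^n,\dots,X_n^n)$ and $(W_1^n,\dots,W_n^n)$ are independent, and for every $\nu\in M_1(\Sigma)$, one has $K(\nu)=I^X(\nu)$, where $K(\nu)=\inf_{\zeta\in M_1(\Sigma)}\{\mathcal{K}(\nu;\zeta)+I^X(\zeta)\}$ is the rate function in the LDP for $L^n=\frac1n\sum_{i=1}^nW_i^n\delta_{X_i^n}$; (ii) for every $\nu,\zeta\in M_1(\Sigma)$, $$\mathcal{K}(\nu;\zeta)=\begin{cases}0&\text{if }\nu=\zeta,\\+\infty&\text{otherwise.}\end{cases}$$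
   Context: LDP means large deviation principle with speed $n$: $(P^n)$ satisfies an LDP with rate function $I$ (nonnegative, lower semicontinuous) if for every measurable $A$, $-\inf_{A^o}I\le\liminf_n\frac1n\log P^n(A)\le\limsup_n\frac1n\log P^n(A)\le-\inf_{\bar A}I$; $I$ is good if its level sets are compact. A sequence of random variables satisfies an LDP if their laws do. $M_1(E)$ denotes the Borel probability measures on $E$; $M_1^1(\mathbb{R}_+)=\{\rho\in M_1(\mathbb{R}_+):\int x\,\rho(dx)=1\}$. For $\rho\in M_1(\mathbb{R}_+\times\Sigma)$, $\rho_1,\rho_2$ are its marginals on $\mathbb{R}_+$ and $\Sigma$; $\mathcal{M}_1^1(\mathbb{R}_+\times\Sigma)=\{\rho:\int x\,\rho_1(dx)=1\}$; $F(\rho)(A)=\int_{\mathbb{R}_+\times A}w\,\rho(dw,dx)$ for measurable $A\subset\Sigma$. $H(\nu|\rho)=\int\log\frac{d\nu}{d\rho}d\nu$ if $\nu\ll\rho$, $+\infty$ otherwise. For $\nu,\zeta\in M_1(\Sigma)$, $\mathcal{K}(\nu;\zeta)=\inf\{H(\rho|\rho_1\otimes\zeta)+I^W(\rho_1):\rho\in\mathcal{M}_1^1(\mathbb{R}_+\times\Sigma),\ \rho_2=\zeta,\ F(\rho)=\nu\}$. Exchangeable means that the law is invariant under every permutation of coordinates. *)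

theory Defs
  imports "HOL-Probability.Probability"
begin

section \<open>Large deviation principles\<close>

definition borel_of_topology :: "'b topology \<Rightarrow> 'b measure" where
  "borel_of_topology T = sigma (topspace T) {U. openin T U}"

definition log_prob :: "real \<Rightarrow> ereal" where
  "log_prob p = (if p = 0 then - \<infinity> else ereal (ln p))"

text \<open>Rate functions are extended-real valued; only their values on \<open>topspace T\<close> matter. Lower
  semicontinuity is closedness of the level sets \<open>{I \<le> a}\<close> for real \<open>a\<close>.\<close>

definition rate_function :: "'b topology \<Rightarrow> ('b \<Rightarrow> ereal) \<Rightarrow> bool" where
  "rate_function T I \<longleftrightarrow>
     (\<forall>x\<in>topspace T. 0 \<le> I x) \<and>
     (\<forall>a::real. closedin T {x \<in> topspace T. I x \<le> ereal a})"

definition good_rate_function :: "'b topology \<Rightarrow> ('b \<Rightarrow> ereal) \<Rightarrow> bool" where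
  "good_rate_function T I \<longleftrightarrow>
     rate_function T I \<and> (\<forall>a::real. compactin T {x \<in> topspace T. I x \<le> ereal a})"

definition LDP_measures :: "'b topology \<Rightarrow> (nat \<Rightarrow> 'b measure) \<Rightarrow> ('b \<Rightarrow> ereal) \<Rightarrow> bool" where
  "LDP_measures T P I \<longleftrightarrow>
     rate_function T I \<and>
     (\<forall>A \<in> sets (borel_of_topology T).
        - (INF x\<in>T interior_of A. I x)
            \<le> liminf (\<lambda>n. ereal (1 / real n) * log_prob (measure (P n) A)) \<and>
        limsup (\<lambda>n. ereal (1 / real n) * log_prob (measure (P n) A))
            \<le> - (INF x\<in>T closure_of A. I x))"

text \<open>The sequence is indexed by \<open>n \<ge> 1\<close>; its entry at \<open>0\<close> is irrelevant.\<close>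

definition LDP :: "'w measure \<Rightarrow> 'b topology \<Rightarrow> (nat \<Rightarrow> 'w \<Rightarrow> 'b) \<Rightarrow> ('b \<Rightarrow> ereal) \<Rightarrow> bool" where
  "LDP M T Y I \<longleftrightarrow>
     (\<forall>n\<ge>1. Y n \<in> measurable M (borel_of_topology T)) \<and>
     LDP_measures T (\<lambda>n. distr M (borel_of_topology T) (Y n)) I"


section \<open>Spaces of probability measures\<close>

text \<open>The nonnegative reals with their Borel sets. A measure on this space is carried by
  \<open>{0..}\<close> by construction.\<close>

abbreviation Rplus :: "real measure" where
  "Rplus \<equiv> restrict_space borel {0..}"

abbreviation prob_measures :: "'b measure \<Rightarrow> 'b measure set" where
  "prob_measures N \<equiv> space (prob_algebra N)"

text \<open>The coarsest topology making \<open>\<mu> \<mapsto> \<integral>f d\<mu>\<close> continuous for every bounded continuous \<open>f\<close>.\<close>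

definition weak_topology :: "'a::topological_space measure topology" where
  "weak_topology = topology_generated_by
     {{\<mu> \<in> prob_measures borel. integral\<^sup>L \<mu> f \<in> U} | (f :: 'a \<Rightarrow> real) U.
        continuous_on UNIV f \<and> bounded (range f) \<and> open U}"

lemma topspace_weak_topology: "topspace weak_topology = prob_measures borel"
proof -
  have "prob_measures borel \<in> {{\<mu> \<in> prob_measures borel. integral\<^sup>L \<mu> f \<in> U} | (f :: 'a \<Rightarrow> real) U.
        continuous_on UNIV f \<and> bounded (range f) \<and> open U}"
    by (rule CollectI, rule exI[of _ "\<lambda>_. 0"], rule exI[of _ UNIV]) auto
  then show ?thesis unfolding weak_topology_def by auto
qed

definition mean_one_measures :: "real measure set" where
  "mean_one_measures = {\<mu> \<in> prob_measures Rplus. (\<integral>\<^sup>+x. ennreal x \<partial>\<mu>) = 1}"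

definition couplings :: "real measure \<Rightarrow> real measure \<Rightarrow> (real \<times> real) measure set" where
  "couplings \<mu> \<nu> = {\<gamma> \<in> prob_measures (Rplus \<Otimes>\<^sub>M Rplus).
     distr \<gamma> Rplus fst = \<mu> \<and> distr \<gamma> Rplus snd = \<nu>}"

text \<open>On \<open>mean_one_measures\<close> the infimum is finite (take the product coupling), so \<open>enn2real\<close> does
  not truncate.\<close>

definition wasserstein1 :: "real measure \<Rightarrow> real measure \<Rightarrow> real" where
  "wasserstein1 \<mu> \<nu> =
     enn2real (INF \<gamma>\<in>couplings \<mu> \<nu>. \<integral>\<^sup>+(x, y). ennreal \<bar>x - y\<bar> \<partial>\<gamma>)"

definition wasserstein_topology :: "real measure topology" where
  "wasserstein_topology = Metric_space.mtopology mean_one_measures wasserstein1"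


section \<open>Empirical measures\<close>

text \<open>The measure \<open>1/n \<Sum>\<^bsub>i=1..n\<^esub> w i \<delta>\<^bsub>x i\<^esub>\<close> on \<open>N\<close>, as the image under \<open>x\<close> of the measure on
  \<open>{1..n}\<close> with point masses \<open>w i / n\<close>.\<close>

definition weighted_empirical ::
    "'b measure \<Rightarrow> nat \<Rightarrow> (nat \<Rightarrow> real) \<Rightarrow> (nat \<Rightarrow> 'b) \<Rightarrow> 'b measure" where
  "weighted_empirical N n w x = distr (point_measure {1..n} (\<lambda>i. ennreal (w i / real n))) N x"

lemma emeasure_weighted_empirical:
  assumes "\<And>i. i \<in> {1..n} \<Longrightarrow> x i \<in> space N" and "A \<in> sets N"
  shows "emeasure (weighted_empirical N n w x) A
           = (\<Sum>i=1..n. ennreal (w i / real n) * indicator A (x i))"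
proof -
  have m: "x \<in> measurable (point_measure {1..n} (\<lambda>i. ennreal (w i / real n))) N"
    using assms(1) by (auto simp: measurable_def space_point_measure sets_point_measure)
  have "emeasure (weighted_empirical N n w x) A = (\<Sum>i\<in>x -` A \<inter> {1..n}. ennreal (w i / real n))"
    unfolding weighted_empirical_def
    by (subst emeasure_distr[OF m assms(2)])
       (auto simp: space_point_measure emeasure_point_measure_finite)
  also have "\<dots> = (\<Sum>i=1..n. ennreal (w i / real n) * indicator A (x i))"
    by (rule sum.mono_neutral_cong_left) (auto simp: indicator_def)
  finally show ?thesis .
qed

abbreviation empirical :: "'b measure \<Rightarrow> nat \<Rightarrow> (nat \<Rightarrow> 'b) \<Rightarrow> 'b measure" where
  "empirical N n x \<equiv> weighted_empirical N n (\<lambda>_. 1) x"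


section \<open>The functionals\<close>

text \<open>The integral of \<open>log (d\<nu>/d\<rho>)\<close> against \<open>\<nu>\<close> as the difference of its positive and negative
  parts (\<open>ennreal\<close> truncates negative reals to \<open>0\<close>). The negative part is at most \<open>1/e\<close>, so the
  difference is meaningful also when the positive part is infinite, where the Bochner integral in
  \<open>KL_divergence\<close> would return \<open>0\<close>. Note the argument order of \<open>entropy_density b \<rho> \<nu>\<close>, which is
  \<open>log b (d\<nu>/d\<rho>)\<close>.\<close>

definition rel_entropy :: "'b measure \<Rightarrow> 'b measure \<Rightarrow> ereal" where
  "rel_entropy \<nu> \<rho> =
     (if absolutely_continuous \<rho> \<nu> then
        enn2ereal (\<integral>\<^sup>+x. ennreal (entropy_density (exp 1) \<rho> \<nu> x) \<partial>\<nu>) -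
        enn2ereal (\<integral>\<^sup>+x. ennreal (- entropy_density (exp 1) \<rho> \<nu> x) \<partial>\<nu>)
      else \<infinity>)"

definition marg1 :: "(real \<times> 'a::topological_space) measure \<Rightarrow> real measure" where
  "marg1 \<rho> = distr \<rho> Rplus fst"

definition marg2 :: "(real \<times> 'a::topological_space) measure \<Rightarrow> 'a measure" where
  "marg2 \<rho> = distr \<rho> borel snd"

definition mean_one_joint :: "(real \<times> 'a::topological_space) measure set" where
  "mean_one_joint =
     {\<rho> \<in> prob_measures (Rplus \<Otimes>\<^sub>M borel). (\<integral>\<^sup>+x. ennreal x \<partial>(marg1 \<rho>)) = 1}"

text \<open>The measure \<open>F(\<rho>)(A) = \<integral> 1\<^sub>A(x) w \<rho>(dw, dx)\<close> as a pushforward; \<open>emeasure_weighted_marg\<close> recovers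
  this formula.\<close>

definition weighted_marg :: "(real \<times> 'a::topological_space) measure \<Rightarrow> 'a measure" where
  "weighted_marg \<rho> = distr (density \<rho> (\<lambda>(w, x). ennreal w)) borel snd"

lemma emeasure_weighted_marg:
  fixes \<rho> :: "(real \<times> 'a::topological_space) measure"
  assumes \<rho>: "sets \<rho> = sets (Rplus \<Otimes>\<^sub>M borel)" and [measurable]: "A \<in> sets borel"
  shows "emeasure (weighted_marg \<rho>) A = (\<integral>\<^sup>+(w, x)\<in>{0..} \<times> A. ennreal w \<partial>\<rho>)"
proof -
  have [measurable_cong]: "sets \<rho> = sets (Rplus \<Otimes>\<^sub>M borel)" by (fact \<rho>)
  have sp: "space \<rho> = {0..} \<times> UNIV"
    using sets_eq_imp_space_eq[OF \<rho>] by (simp add: space_pair_measure)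
  have id: "(\<lambda>x::real. x) \<in> borel_measurable Rplus"
    by (rule measurable_restrict_space1) simp
  have "fst \<in> borel_measurable \<rho>"
    using measurable_compose[OF measurable_fst[of Rplus "borel::'a measure"] id]
    by (simp add: measurable_cong_sets[OF \<rho> refl])
  then have d: "(\<lambda>(w, x). ennreal w) \<in> borel_measurable \<rho>"
    unfolding split_beta by measurable
  have "emeasure (weighted_marg \<rho>) A
      = emeasure (density \<rho> (\<lambda>(w, x). ennreal w)) (snd -` A \<inter> space \<rho>)"
    unfolding weighted_marg_def by (subst emeasure_distr) auto
  also have "\<dots> = (\<integral>\<^sup>+z. (case z of (w, x) \<Rightarrow> ennreal w) * indicator (snd -` A \<inter> space \<rho>) z \<partial>\<rho>)"
    by (rule emeasure_density[OF d]) measurable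
  also have "\<dots> = (\<integral>\<^sup>+(w, x)\<in>{0..} \<times> A. ennreal w \<partial>\<rho>)"
    by (rule nn_integral_cong) (auto simp: sp indicator_def)
  finally show ?thesis .
qed

definition calK :: "(real measure \<Rightarrow> ereal) \<Rightarrow>
    'a::topological_space measure \<Rightarrow> 'a measure \<Rightarrow> ereal" where
  "calK IW \<nu> \<zeta> =
     Inf {rel_entropy \<rho> (marg1 \<rho> \<Otimes>\<^sub>M \<zeta>) + IW (marg1 \<rho>) | \<rho>.
            \<rho> \<in> mean_one_joint \<and> marg2 \<rho> = \<zeta> \<and> weighted_marg \<rho> = \<nu>}"

definition rateK :: "(real measure \<Rightarrow> ereal) \<Rightarrow> ('a::topological_space measure \<Rightarrow> ereal) \<Rightarrow>
    'a measure \<Rightarrow> ereal" where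
  "rateK IW IX \<nu> = (INF \<zeta>\<in>prob_measures borel. calK IW \<nu> \<zeta> + IX \<zeta>)"


section \<open>Triangular arrays\<close>

text \<open>An array is a family \<open>W n i\<close>, of which only the entries with \<open>1 \<le> i \<le> n\<close> are used.\<close>

abbreviation row :: "(nat \<Rightarrow> nat \<Rightarrow> 'w \<Rightarrow> 'b) \<Rightarrow> nat \<Rightarrow> 'w \<Rightarrow> nat \<Rightarrow> 'b" where
  "row X n \<omega> \<equiv> (\<lambda>i\<in>{1..n}. X n i \<omega>)"

definition triangular_array ::
    "'w measure \<Rightarrow> 'b measure \<Rightarrow> (nat \<Rightarrow> nat \<Rightarrow> 'w \<Rightarrow> 'b) \<Rightarrow> bool" where
  "triangular_array M N X \<longleftrightarrow> (\<forall>n\<ge>1. \<forall>i\<in>{1..n}. X n i \<in> measurable M N)"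

definition exchangeable_row ::
    "'w measure \<Rightarrow> 'b measure \<Rightarrow> nat \<Rightarrow> (nat \<Rightarrow> 'w \<Rightarrow> 'b) \<Rightarrow> bool" where
  "exchangeable_row M N n Y \<longleftrightarrow>
     (\<forall>p. p permutes {1..n} \<longrightarrow>
        distr M (PiM {1..n} (\<lambda>_. N)) (\<lambda>\<omega>. \<lambda>i\<in>{1..n}. Y (p i) \<omega>) =
        distr M (PiM {1..n} (\<lambda>_. N)) (\<lambda>\<omega>. \<lambda>i\<in>{1..n}. Y i \<omega>))"

text \<open>Independence of random variables with values in different types, as independence of the
  generated sigma-algebras; the library's \<open>indep_var\<close> requires both value types to be equal.\<close>

definition independent_rvs ::
    "'w measure \<Rightarrow> 'b measure \<Rightarrow> ('w \<Rightarrow> 'b) \<Rightarrow> 'c measure \<Rightarrow> ('w \<Rightarrow> 'c) \<Rightarrow> bool" where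
  "independent_rvs M N Y N' Y' \<longleftrightarrow>
     prob_space.indep_set M (sets (vimage_algebra (space M) Y N))
                            (sets (vimage_algebra (space M) Y' N'))"

definition admissible_array :: "'w measure \<Rightarrow> (nat \<Rightarrow> nat \<Rightarrow> 'w \<Rightarrow> real) \<Rightarrow>
    (nat \<Rightarrow> nat \<Rightarrow> 'w \<Rightarrow> 'a::topological_space) \<Rightarrow> ('a measure \<Rightarrow> ereal) \<Rightarrow> bool" where
  "admissible_array M W X IX \<longleftrightarrow>
     triangular_array M borel X \<and>
     good_rate_function weak_topology IX \<and>
     LDP M weak_topology (\<lambda>n \<omega>. empirical borel n (\<lambda>i. X n i \<omega>)) IX \<and>
     (\<forall>n\<ge>1. independent_rvs M (PiM {1..n} (\<lambda>_. borel)) (row X n)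
                               (PiM {1..n} (\<lambda>_. Rplus)) (row W n))"

end

theory Submission
  imports Defs
begin

text \<open>For (i) implies (ii), take deterministic \<open>X\<close> whose empirical measures converge to \<open>\<zeta>\<close>: then
  \<open>I\<^sup>X\<close> vanishes at \<open>\<zeta>\<close> and is infinite elsewhere, so \<open>K(\<nu>)\<close> is the two-argument functional at
  \<open>(\<nu>, \<zeta>)\<close>. Conversely (ii) makes \<open>K = I\<^sup>X\<close> immediate. For the LDP of \<open>L\<^sup>n\<close>, if the state space has
  two points then (ii) forces \<open>I\<^sup>W = \<infinity>\<close> off \<open>\<delta>\<^sub>1\<close>: any other weight law, coloured according to
  whether \<open>w > 1\<close>, has finite cost but moves mass. Hence the average of \<open>\<bar>W\<^sub>i - 1\<bar>\<close> is
  superexponentially small and \<open>L\<^sup>n\<close> is exponentially equivalent to the empirical measure of \<open>X\<close>.\<close>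

section \<open>The Wasserstein distance and quantiles\<close>

text \<open>The theorem covers two readings of (i): \<open>?i\<close> asks only for K = I^X, while
  \<open>?i'\<close> asks in addition that L^n satisfy the LDP with rate K. The weaker reading
  already forces (ii), and (ii) yields the stronger one, so a single cycle settles both. The LDP of
  L^n is needed only under (ii), where comparison with the unweighted empirical measure suffices.

  The colouring threshold 1 comes from the mean: a law of mean one other than the Dirac mass at 1
  charges both \<open>w > 1\<close> and \<open>w \<le> 1\<close>, so both colours have positive mass
  and the joint density is bounded. On a one-point state space (ii) says nothing about I^W, but
  there L^n and the empirical measure of X coincide.

  Turning I^W = \<infinity> into a tail bound requires that complements of balls around the Dirac
  mass be closed, hence the metric axioms for the Wasserstein distance; this is the purpose of the
  quantiles. The weak topology is accessed through its subbasis alone, without a metric for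
  it.\<close>

lemma id_measurable_Rplus: "(\<lambda>x. x) \<in> measurable Rplus borel"
  by (rule measurable_restrict_space1) simp

lemma sets_Rplus_borel: "A \<in> sets Rplus \<Longrightarrow> A \<in> sets borel \<and> A \<subseteq> {0..}"
  by (auto simp: sets_restrict_space)

lemma prob_algebraD:
  assumes "\<mu> \<in> prob_measures N"
  shows "prob_space \<mu>" "sets \<mu> = sets N"
  using assms by (auto simp: space_prob_algebra)

text \<open>Generalised inverse of the distribution function. The push-forward to
  \<open>borel\<close> matters: half lines \<open>{..x}\<close> are not measurable in
  \<open>Rplus\<close>, so \<open>cdf\<close> of \<mu> itself would be 0.\<close>

definition quantile :: "real measure \<Rightarrow> real \<Rightarrow> real" where
  "quantile \<mu> u = Inf {x. u \<le> cdf (distr \<mu> borel (\<lambda>x. x)) x}"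

abbreviation unit_lborel :: "real measure" where
  "unit_lborel \<equiv> restrict_space lborel {0<..<1}"

lemma space_unit_lborel: "space unit_lborel = {0<..<1}"
  by (simp add: space_restrict_space)

lemma prob_space_unit_lborel: "prob_space unit_lborel"
  by (auto simp: space_restrict_space emeasure_restrict_space intro!: prob_spaceI)

context
  fixes \<mu> :: "real measure"
  assumes \<mu>: "\<mu> \<in> prob_measures Rplus"
begin

lemma cdf_distribution_Rplus: "cdf_distribution (distr \<mu> borel (\<lambda>x. x))"
proof -
  interpret prob_space \<mu> using prob_algebraD(1)[OF \<mu>] .
  have m: "(\<lambda>x. x) \<in> measurable \<mu> borel"
    using id_measurable_Rplus by (simp add: measurable_cong_sets[OF prob_algebraD(2)[OF \<mu>] refl])
  interpret D: prob_space "distr \<mu> borel (\<lambda>x. x)" using m by (rule prob_space_distr)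
  show ?thesis
    by unfold_locales auto
qed

lemma quantile_le_iff:
  assumes "u \<in> {0<..<1}"
  shows "quantile \<mu> u \<le> x \<longleftrightarrow> u \<le> cdf (distr \<mu> borel (\<lambda>x. x)) x"
proof -
  interpret cdf_distribution "distr \<mu> borel (\<lambda>x. x)" by (rule cdf_distribution_Rplus)
  show ?thesis using pseudoinverse[of u x] assms by (simp add: quantile_def)
qed

text \<open>At a negative point the distribution function is 0, whereas the Galois connection
  applied at the quantile itself gives at least u > 0.\<close>

lemma quantile_nonneg:
  assumes u: "u \<in> {0<..<1}"
  shows "0 \<le> quantile \<mu> u"
proof (rule ccontr)
  assume "\<not> 0 \<le> quantile \<mu> u"
  have sp: "space \<mu> = {0..}"
    using sets_eq_imp_space_eq[OF prob_algebraD(2)[OF \<mu>]] by (simp add: space_restrict_space)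
  have m: "(\<lambda>x. x) \<in> measurable \<mu> borel"
    using id_measurable_Rplus by (simp add: measurable_cong_sets[OF prob_algebraD(2)[OF \<mu>] refl])
  have "{..quantile \<mu> u} \<inter> {0..} = {}" using \<open>\<not> 0 \<le> quantile \<mu> u\<close> by auto
  then have "cdf (distr \<mu> borel (\<lambda>x. x)) (quantile \<mu> u) = 0"
    unfolding cdf_def using m by (subst measure_distr) (auto simp: sp)
  then show False using quantile_le_iff[OF u, of "quantile \<mu> u"] u by simp
qed

lemma quantile_measurable: "quantile \<mu> \<in> measurable unit_lborel Rplus"
proof -
  interpret cdf_distribution "distr \<mu> borel (\<lambda>x. x)" by (rule cdf_distribution_Rplus)
  have "quantile \<mu> \<in> borel_measurable (restrict_space borel {0<..<1})"
    using measurable_CI by (simp add: quantile_def[abs_def])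
  then have "quantile \<mu> \<in> measurable unit_lborel borel"
    by (subst measurable_cong_sets[of _ "restrict_space borel {0<..<1}" borel borel])
       (auto simp: sets_restrict_space)
  then show ?thesis
    using quantile_nonneg by (intro measurable_restrict_space2) (auto simp: space_unit_lborel)
qed

text \<open>Inverse transform sampling. The classical identity lives on \<open>borel\<close>; it
  descends to \<open>Rplus\<close> because both laws are carried by \<open>{0..}\<close>.\<close>

lemma distr_quantile: "distr unit_lborel Rplus (quantile \<mu>) = \<mu>"
proof (rule measure_eqI)
  interpret cdf_distribution "distr \<mu> borel (\<lambda>x. x)" by (rule cdf_distribution_Rplus)
  show "sets (distr unit_lborel Rplus (quantile \<mu>)) = sets \<mu>"
    using prob_algebraD[OF \<mu>] by simp
  have sp: "space \<mu> = {0..}"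
    using sets_eq_imp_space_eq[OF prob_algebraD(2)[OF \<mu>]] by (simp add: space_restrict_space)
  have m: "(\<lambda>x. x) \<in> measurable \<mu> borel"
    using id_measurable_Rplus by (simp add: measurable_cong_sets[OF prob_algebraD(2)[OF \<mu>] refl])
  fix A assume "A \<in> sets (distr unit_lborel Rplus (quantile \<mu>))"
  then have A: "A \<in> sets Rplus" by simp
  have Ab: "A \<in> sets borel" "A \<subseteq> {0..}" using sets_Rplus_borel[OF A] by auto
  have Q: "quantile \<mu> \<in> measurable unit_lborel borel"
    using measurable_compose[OF quantile_measurable id_measurable_Rplus] by simp
  have "emeasure (distr unit_lborel Rplus (quantile \<mu>)) A = emeasure (distr unit_lborel borel (quantile \<mu>)) A"
    using A Ab Q by (simp add: emeasure_distr quantile_measurable)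
  also have "distr unit_lborel borel (quantile \<mu>) = distr \<mu> borel (\<lambda>x. x)"
    using distr_I_eq_M by (simp add: quantile_def[abs_def])
  also have "emeasure \<dots> A = emeasure \<mu> A"
    using Ab m by (subst emeasure_distr) (auto simp: sp intro!: arg_cong[where f="emeasure \<mu>"])
  finally show "emeasure (distr unit_lborel Rplus (quantile \<mu>)) A = emeasure \<mu> A" .
qed

end

section \<open>Transport cost as an integral over levels\<close>

lemma ennreal_abs_diff_eq_nn_integral:
  "ennreal \<bar>x - y\<bar> = (\<integral>\<^sup>+t. indicator {x..<y} t + indicator {y..<x} t \<partial>lborel)"
  by (subst nn_integral_add) (auto simp: emeasure_lborel_Ico max_def abs_if)

text \<open>Layer-cake: |X - Y| is the length of the set of levels t that separate X from Y, and
  Fubini turns the mean of this length into an integral of probabilities.\<close>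

lemma nn_integral_abs_diff:
  assumes "prob_space N" and [measurable]: "X \<in> borel_measurable N" "Y \<in> borel_measurable N"
  shows "(\<integral>\<^sup>+\<omega>. ennreal \<bar>X \<omega> - Y \<omega>\<bar> \<partial>N) =
    (\<integral>\<^sup>+t. ennreal (measure N ({\<omega> \<in> space N. X \<omega> \<le> t} - {\<omega> \<in> space N. Y \<omega> \<le> t}) +
                measure N ({\<omega> \<in> space N. Y \<omega> \<le> t} - {\<omega> \<in> space N. X \<omega> \<le> t})) \<partial>lborel)"
proof -
  interpret prob_space N by fact
  interpret pair_sigma_finite lborel N ..
  have "(\<integral>\<^sup>+\<omega>. ennreal \<bar>X \<omega> - Y \<omega>\<bar> \<partial>N) =
    (\<integral>\<^sup>+\<omega>. (\<integral>\<^sup>+t. indicator {X \<omega>..<Y \<omega>} t + indicator {Y \<omega>..<X \<omega>} t \<partial>lborel) \<partial>N)"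
    by (simp add: ennreal_abs_diff_eq_nn_integral)
  also have "\<dots> = (\<integral>\<^sup>+t. (\<integral>\<^sup>+\<omega>. indicator {X \<omega>..<Y \<omega>} t + indicator {Y \<omega>..<X \<omega>} t \<partial>N) \<partial>lborel)"
    \<comment> \<open>Written as comparisons, the indicators are visibly jointly measurable in t and
      \<omega>.\<close>
    unfolding indicator_def of_bool_def atLeastLessThan_iff
    by (rule Fubini') measurable
  also have "\<dots> = (\<integral>\<^sup>+t. ennreal (measure N ({\<omega> \<in> space N. X \<omega> \<le> t} - {\<omega> \<in> space N. Y \<omega> \<le> t}) +
                measure N ({\<omega> \<in> space N. Y \<omega> \<le> t} - {\<omega> \<in> space N. X \<omega> \<le> t})) \<partial>lborel)"
  proof (rule nn_integral_cong)
    fix t :: real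
    let ?A = "{\<omega> \<in> space N. X \<omega> \<le> t} - {\<omega> \<in> space N. Y \<omega> \<le> t}"
    let ?B = "{\<omega> \<in> space N. Y \<omega> \<le> t} - {\<omega> \<in> space N. X \<omega> \<le> t}"
    have "(\<integral>\<^sup>+\<omega>. indicator {X \<omega>..<Y \<omega>} t + indicator {Y \<omega>..<X \<omega>} t \<partial>N) =
      (\<integral>\<^sup>+\<omega>. indicator ?A \<omega> + indicator ?B \<omega> \<partial>N)"
      by (rule nn_integral_cong) (auto simp: indicator_def)
    also have "\<dots> = emeasure N ?A + emeasure N ?B"
      by (subst nn_integral_add) auto
    finally show "(\<integral>\<^sup>+\<omega>. indicator {X \<omega>..<Y \<omega>} t + indicator {Y \<omega>..<X \<omega>} t \<partial>N) =
      ennreal (measure N ?A + measure N ?B)"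
      by (simp add: emeasure_eq_measure)
  qed
  finally show ?thesis .
qed

text \<open>At each level, two events differ in probability by at most the probability of their
  symmetric difference. This bounds the cost of every coupling from below by a quantity that depends
  on the marginals alone.\<close>

lemma nn_integral_abs_diff_ge:
  assumes "prob_space N" and [measurable]: "X \<in> borel_measurable N" "Y \<in> borel_measurable N"
  shows "(\<integral>\<^sup>+t. ennreal \<bar>cdf (distr N borel X) t - cdf (distr N borel Y) t\<bar> \<partial>lborel)
    \<le> (\<integral>\<^sup>+\<omega>. ennreal \<bar>X \<omega> - Y \<omega>\<bar> \<partial>N)"
  unfolding nn_integral_abs_diff[OF assms]
proof (intro nn_integral_mono ennreal_leI)
  interpret prob_space N by fact
  fix t
  let ?A = "{\<omega> \<in> space N. X \<omega> \<le> t}" and ?B = "{\<omega> \<in> space N. Y \<omega> \<le> t}"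
  have [measurable]: "?A \<in> sets N" "?B \<in> sets N" by measurable
  have c: "cdf (distr N borel X) t = measure N ?A" "cdf (distr N borel Y) t = measure N ?B"
    unfolding cdf_def by (auto simp: measure_distr intro!: arg_cong[where f="measure N"])
  have "measure N (?A - ?B) = measure N ?A - measure N (?A \<inter> ?B)"
       "measure N (?B - ?A) = measure N ?B - measure N (?B \<inter> ?A)"
    by (intro finite_measure_Diff'; measurable)+
  moreover have "measure N (?A \<inter> ?B) \<le> measure N ?A" "measure N (?A \<inter> ?B) \<le> measure N ?B"
    by (intro finite_measure_mono; auto)+
  ultimately show "\<bar>cdf (distr N borel X) t - cdf (distr N borel Y) t\<bar> \<le> measure N (?A - ?B) + measure N (?B - ?A)"
    unfolding c by (simp add: Int_commute)
qed

text \<open>For nested level sets one of the two differences is empty, so the general lower bound is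
  attained. Comonotone pairs, such as two quantile functions of the same u, have nested level
  sets.\<close>

lemma nn_integral_abs_diff_eq:
  assumes "prob_space N" and [measurable]: "X \<in> borel_measurable N" "Y \<in> borel_measurable N"
    and nested: "\<And>t. {\<omega> \<in> space N. X \<omega> \<le> t} \<subseteq> {\<omega> \<in> space N. Y \<omega> \<le> t} \<or>
                {\<omega> \<in> space N. Y \<omega> \<le> t} \<subseteq> {\<omega> \<in> space N. X \<omega> \<le> t}"
  shows "(\<integral>\<^sup>+\<omega>. ennreal \<bar>X \<omega> - Y \<omega>\<bar> \<partial>N) =
    (\<integral>\<^sup>+t. ennreal \<bar>cdf (distr N borel X) t - cdf (distr N borel Y) t\<bar> \<partial>lborel)"
  unfolding nn_integral_abs_diff[OF assms(1-3)]
proof (intro nn_integral_cong arg_cong[where f=ennreal])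
  interpret prob_space N by fact
  fix t
  let ?A = "{\<omega> \<in> space N. X \<omega> \<le> t}" and ?B = "{\<omega> \<in> space N. Y \<omega> \<le> t}"
  have [measurable]: "?A \<in> sets N" "?B \<in> sets N" by measurable
  have c: "cdf (distr N borel X) t = measure N ?A" "cdf (distr N borel Y) t = measure N ?B"
    unfolding cdf_def by (auto simp: measure_distr intro!: arg_cong[where f="measure N"])
  have "measure N (?A - ?B) = measure N ?A - measure N (?A \<inter> ?B)"
       "measure N (?B - ?A) = measure N ?B - measure N (?B \<inter> ?A)"
    by (intro finite_measure_Diff'; measurable)+
  moreover have "measure N (?A \<inter> ?B) \<le> measure N ?A" "measure N (?A \<inter> ?B) \<le> measure N ?B"
    by (intro finite_measure_mono; auto)+
  moreover have "?A \<inter> ?B = ?A \<or> ?A \<inter> ?B = ?B" using nested[of t] by blast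
  ultimately show "measure N (?A - ?B) + measure N (?B - ?A) = \<bar>cdf (distr N borel X) t - cdf (distr N borel Y) t\<bar>"
    unfolding c by (auto simp: Int_commute)
qed

text \<open>The quantile coupling attains the infimum, so \<open>wasserstein1\<close> is an \<open>L\<^sup>1\<close> distance of quantile
  functions; this yields the triangle inequality without gluing couplings.\<close>

lemma INF_couplings_eq:
  assumes \<mu>: "\<mu> \<in> prob_measures Rplus" and \<nu>: "\<nu> \<in> prob_measures Rplus"
  shows "(INF \<gamma>\<in>couplings \<mu> \<nu>. \<integral>\<^sup>+(x, y). ennreal \<bar>x - y\<bar> \<partial>\<gamma>) =
    (\<integral>\<^sup>+u. ennreal \<bar>quantile \<mu> u - quantile \<nu> u\<bar> \<partial>unit_lborel)" (is "?L = ?R")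
proof (rule antisym)
  interpret U: prob_space unit_lborel by (rule prob_space_unit_lborel)
  note [measurable] = id_measurable_Rplus quantile_measurable[OF \<mu>] quantile_measurable[OF \<nu>]
  let ?F = "\<lambda>\<mu>. cdf (distr \<mu> borel (\<lambda>x. x))"
  let ?q = "\<lambda>u. (quantile \<mu> u, quantile \<nu> u)"
  have q: "?q \<in> measurable unit_lborel (Rplus \<Otimes>\<^sub>M Rplus)" by measurable
  \<comment> \<open>Both quantiles are driven by the same uniform variable: the monotone coupling,
    which is optimal on the line.\<close>
  have "distr unit_lborel (Rplus \<Otimes>\<^sub>M Rplus) ?q \<in> couplings \<mu> \<nu>"
    using q by (simp add: couplings_def space_prob_algebra U.prob_space_distr distr_distr comp_def
        distr_quantile[OF \<mu>] distr_quantile[OF \<nu>])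
  then have "?L \<le> (\<integral>\<^sup>+(x, y). ennreal \<bar>x - y\<bar> \<partial>distr unit_lborel (Rplus \<Otimes>\<^sub>M Rplus) ?q)"
    by (rule INF_lower)
  also have "\<dots> = ?R"
    by (subst nn_integral_distr[OF q]) (auto simp: case_prod_unfold)
  finally show "?L \<le> ?R" .
  have D: "distr unit_lborel borel (quantile \<mu>) = distr \<mu> borel (\<lambda>x. x)" if "\<mu> \<in> prob_measures Rplus" for \<mu>
  proof -
    have "distr \<mu> borel (\<lambda>x. x) = distr (distr unit_lborel Rplus (quantile \<mu>)) borel (\<lambda>x. x)"
      by (simp add: distr_quantile that)
    also have "\<dots> = distr unit_lborel borel (quantile \<mu>)"
      by (subst distr_distr) (auto simp: comp_def quantile_measurable that)
    finally show ?thesis ..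
  qed
  \<comment> \<open>The level sets of both quantiles are initial segments of the unit interval, cut
    off at the value of the distribution function, hence nested.\<close>
  have R: "?R = (\<integral>\<^sup>+t. ennreal \<bar>?F \<mu> t - ?F \<nu> t\<bar> \<partial>lborel)"
  proof (subst nn_integral_abs_diff_eq[OF prob_space_unit_lborel])
    fix t
    show "{\<omega> \<in> space unit_lborel. quantile \<mu> \<omega> \<le> t} \<subseteq> {\<omega> \<in> space unit_lborel. quantile \<nu> \<omega> \<le> t} \<or>
      {\<omega> \<in> space unit_lborel. quantile \<nu> \<omega> \<le> t} \<subseteq> {\<omega> \<in> space unit_lborel. quantile \<mu> \<omega> \<le> t}"
      using linear[of "?F \<mu> t" "?F \<nu> t"]
      by (auto simp: space_unit_lborel quantile_le_iff[OF \<mu>] quantile_le_iff[OF \<nu>])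
  qed (auto simp: D \<mu> \<nu>)
  show "?R \<le> ?L"
  proof (rule INF_greatest)
    fix \<gamma> assume \<gamma>: "\<gamma> \<in> couplings \<mu> \<nu>"
    then have ps: "prob_space \<gamma>" and [measurable_cong]: "sets \<gamma> = sets (Rplus \<Otimes>\<^sub>M Rplus)"
      and d: "distr \<gamma> Rplus fst = \<mu>" "distr \<gamma> Rplus snd = \<nu>"
      by (auto simp: couplings_def space_prob_algebra)
    have [measurable]: "fst \<in> borel_measurable \<gamma>" "snd \<in> borel_measurable \<gamma>"
      using measurable_compose[OF measurable_fst id_measurable_Rplus, of Rplus]
        measurable_compose[OF measurable_snd id_measurable_Rplus, of Rplus]
      by measurable
    have d': "distr \<gamma> borel fst = distr \<mu> borel (\<lambda>x. x)" "distr \<gamma> borel snd = distr \<nu> borel (\<lambda>x. x)"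
      unfolding d[symmetric] by (subst distr_distr; auto simp: comp_def)+
    show "?R \<le> (\<integral>\<^sup>+(x, y). ennreal \<bar>x - y\<bar> \<partial>\<gamma>)"
      using nn_integral_abs_diff_ge[OF ps, of fst snd] by (simp add: R d' case_prod_unfold)
  qed
qed

section \<open>Metric axioms for the Wasserstein distance\<close>

lemma couplings_swap:
  assumes "\<gamma> \<in> couplings \<mu> \<nu>"
  shows "distr \<gamma> (Rplus \<Otimes>\<^sub>M Rplus) (\<lambda>(x, y). (y, x)) \<in> couplings \<nu> \<mu>"
    and "(\<integral>\<^sup>+(x, y). ennreal \<bar>x - y\<bar> \<partial>distr \<gamma> (Rplus \<Otimes>\<^sub>M Rplus) (\<lambda>(x, y). (y, x))) =
      (\<integral>\<^sup>+(x, y). ennreal \<bar>x - y\<bar> \<partial>\<gamma>)"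
proof -
  note [measurable] = id_measurable_Rplus
  have ps: "prob_space \<gamma>" and [measurable_cong]: "sets \<gamma> = sets (Rplus \<Otimes>\<^sub>M Rplus)"
    using assms by (auto simp: couplings_def space_prob_algebra)
  have m: "(\<lambda>(x, y). (y, x)) \<in> measurable \<gamma> (Rplus \<Otimes>\<^sub>M Rplus)" by measurable
  show "distr \<gamma> (Rplus \<Otimes>\<^sub>M Rplus) (\<lambda>(x, y). (y, x)) \<in> couplings \<nu> \<mu>"
    using assms m by (auto simp: couplings_def space_prob_algebra prob_space.prob_space_distr
        distr_distr comp_def case_prod_unfold)
  show "(\<integral>\<^sup>+(x, y). ennreal \<bar>x - y\<bar> \<partial>distr \<gamma> (Rplus \<Otimes>\<^sub>M Rplus) (\<lambda>(x, y). (y, x))) =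
      (\<integral>\<^sup>+(x, y). ennreal \<bar>x - y\<bar> \<partial>\<gamma>)"
    by (subst nn_integral_distr[OF m]) (auto simp: case_prod_unfold abs_minus_commute)
qed

lemma wasserstein1_commute: "wasserstein1 \<mu> \<nu> = wasserstein1 \<nu> \<mu>"
proof -
  have "(INF \<gamma>\<in>couplings \<mu> \<nu>. \<integral>\<^sup>+(x, y). ennreal \<bar>x - y\<bar> \<partial>\<gamma>) \<le>
    (INF \<gamma>\<in>couplings \<nu> \<mu>. \<integral>\<^sup>+(x, y). ennreal \<bar>x - y\<bar> \<partial>\<gamma>)" for \<mu> \<nu>
  proof (rule INF_greatest)
    fix \<gamma> assume "\<gamma> \<in> couplings \<nu> \<mu>"
    from INF_lower[OF couplings_swap(1)[OF this], of "\<lambda>\<gamma>. \<integral>\<^sup>+(x, y). ennreal \<bar>x - y\<bar> \<partial>\<gamma>"]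
    show "(INF \<gamma>\<in>couplings \<mu> \<nu>. \<integral>\<^sup>+(x, y). ennreal \<bar>x - y\<bar> \<partial>\<gamma>) \<le> (\<integral>\<^sup>+(x, y). ennreal \<bar>x - y\<bar> \<partial>\<gamma>)"
      by (simp only: couplings_swap(2)[OF \<open>\<gamma> \<in> couplings \<nu> \<mu>\<close>])
  qed
  then show ?thesis
    unfolding wasserstein1_def by (intro arg_cong[where f=enn2real] antisym)
qed

lemma nn_integral_quantile_mean_one:
  assumes "\<mu> \<in> mean_one_measures"
  shows "(\<integral>\<^sup>+u. ennreal (quantile \<mu> u) \<partial>unit_lborel) = 1"
proof -
  have \<mu>: "\<mu> \<in> prob_measures Rplus" "(\<integral>\<^sup>+x. ennreal x \<partial>\<mu>) = 1"
    using assms by (auto simp: mean_one_measures_def)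
  have "(\<integral>\<^sup>+u. ennreal (quantile \<mu> u) \<partial>unit_lborel)
      = (\<integral>\<^sup>+x. ennreal x \<partial>distr unit_lborel Rplus (quantile \<mu>))"
    using id_measurable_Rplus by (subst nn_integral_distr[OF quantile_measurable[OF \<mu>(1)]]) auto
  then show ?thesis using \<mu> by (simp add: distr_quantile)
qed

text \<open>Both quantiles are nonnegative with integral one, so the distance is at most 2.
  Finiteness makes \<open>enn2real\<close> additive, and it excludes that a zero of
  \<open>enn2real\<close> stems from \<infinity>.\<close>

lemma nn_integral_quantile_diff_finite:
  assumes "\<mu> \<in> mean_one_measures" "\<nu> \<in> mean_one_measures"
  shows "(\<integral>\<^sup>+u. ennreal \<bar>quantile \<mu> u - quantile \<nu> u\<bar> \<partial>unit_lborel) < \<infinity>"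
proof -
  have M: "\<mu> \<in> prob_measures Rplus" if "\<mu> \<in> mean_one_measures" for \<mu>
    using that by (simp add: mean_one_measures_def)
  have Q: "quantile \<mu> \<in> measurable unit_lborel borel" if "\<mu> \<in> mean_one_measures" for \<mu>
    using measurable_compose[OF quantile_measurable[OF M[OF that]] id_measurable_Rplus] by simp
  note [measurable] = Q[OF assms(1)] Q[OF assms(2)]
  have "(\<integral>\<^sup>+u. ennreal \<bar>quantile \<mu> u - quantile \<nu> u\<bar> \<partial>unit_lborel) \<le> (\<integral>\<^sup>+u. ennreal (quantile \<mu> u) + ennreal (quantile \<nu> u) \<partial>unit_lborel)"
  proof (rule nn_integral_mono)
    fix u assume "u \<in> space unit_lborel"
    then have "0 \<le> quantile \<mu> u" "0 \<le> quantile \<nu> u"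
      using quantile_nonneg M assms by (simp_all add: space_unit_lborel)
    then show "ennreal \<bar>quantile \<mu> u - quantile \<nu> u\<bar> \<le> ennreal (quantile \<mu> u) + ennreal (quantile \<nu> u)"
      by (subst ennreal_plus[symmetric]) (assumption+, rule ennreal_leI, linarith)
  qed
  also have "\<dots> = 1 + 1"
    by (subst nn_integral_add) (simp_all add: nn_integral_quantile_mean_one assms)
  finally show ?thesis by (rule order.strict_trans1) simp
qed

text \<open>The quantile function embeds the carrier isometrically into L^1 of the unit interval;
  the embedding is injective because a measure is the law of its quantile function.\<close>

lemma Metric_space_wasserstein1: "Metric_space mean_one_measures wasserstein1"
proof
  let ?d = "\<lambda>\<mu> \<nu>. \<integral>\<^sup>+u. ennreal \<bar>quantile \<mu> u - quantile \<nu> u\<bar> \<partial>unit_lborel"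
  have M: "\<mu> \<in> prob_measures Rplus" if "\<mu> \<in> mean_one_measures" for \<mu>
    using that by (simp add: mean_one_measures_def)
  have Q: "quantile \<mu> \<in> measurable unit_lborel borel" if "\<mu> \<in> mean_one_measures" for \<mu>
    using measurable_compose[OF quantile_measurable[OF M[OF that]] id_measurable_Rplus] by simp
  have w: "wasserstein1 \<mu> \<nu> = enn2real (?d \<mu> \<nu>)" if "\<mu> \<in> mean_one_measures" "\<nu> \<in> mean_one_measures" for \<mu> \<nu>
    unfolding wasserstein1_def using that by (subst INF_couplings_eq) (auto dest: M)
  note fin = nn_integral_quantile_diff_finite
  show "0 \<le> wasserstein1 \<mu> \<nu>" for \<mu> \<nu> by (simp add: wasserstein1_def)
  show "wasserstein1 \<mu> \<nu> = wasserstein1 \<nu> \<mu>" for \<mu> \<nu> by (rule wasserstein1_commute)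
  fix \<mu> \<nu> assume \<mu>: "\<mu> \<in> mean_one_measures" and \<nu>: "\<nu> \<in> mean_one_measures"
  note [measurable] = Q[OF \<mu>] Q[OF \<nu>]
  show "wasserstein1 \<mu> \<nu> = 0 \<longleftrightarrow> \<mu> = \<nu>"
  proof
    assume "\<mu> = \<nu>" then show "wasserstein1 \<mu> \<nu> = 0" by (simp add: w[OF \<nu> \<nu>])
  next
    assume "wasserstein1 \<mu> \<nu> = 0"
    then have "?d \<mu> \<nu> = 0"
      using fin[OF \<mu> \<nu>] unfolding w[OF \<mu> \<nu>] enn2real_eq_0_iff by (metis less_irrefl infinity_ennreal_def)
    then have "AE u in unit_lborel. quantile \<mu> u = quantile \<nu> u"
      by (subst (asm) nn_integral_0_iff_AE) simp_all
    then have "distr unit_lborel Rplus (quantile \<mu>) = distr unit_lborel Rplus (quantile \<nu>)"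
      using quantile_measurable[OF M[OF \<mu>]] quantile_measurable[OF M[OF \<nu>]]
      by (intro distr_cong_AE) auto
    then show "\<mu> = \<nu>" by (simp add: distr_quantile M \<mu> \<nu>)
  qed
  fix \<rho> assume \<rho>: "\<rho> \<in> mean_one_measures"
  note [measurable] = Q[OF \<mu>] Q[OF \<nu>] Q[OF \<rho>]
  have "?d \<mu> \<rho> \<le> (\<integral>\<^sup>+u. ennreal \<bar>quantile \<mu> u - quantile \<nu> u\<bar> + ennreal \<bar>quantile \<nu> u - quantile \<rho> u\<bar> \<partial>unit_lborel)"
    by (intro nn_integral_mono, subst ennreal_plus[symmetric])
       (rule abs_ge_zero, rule abs_ge_zero, rule ennreal_leI, linarith)
  also have "\<dots> = ?d \<mu> \<nu> + ?d \<nu> \<rho>"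
    by (rule nn_integral_add) auto
  finally have "enn2real (?d \<mu> \<rho>) \<le> enn2real (?d \<mu> \<nu> + ?d \<nu> \<rho>)"
    using fin[OF \<mu> \<nu>] fin[OF \<nu> \<rho>] by (intro enn2real_mono) simp_all
  also have "\<dots> = enn2real (?d \<mu> \<nu>) + enn2real (?d \<nu> \<rho>)"
    using fin[OF \<mu> \<nu>] fin[OF \<nu> \<rho>] by (intro enn2real_plus) simp_all
  finally show "wasserstein1 \<mu> \<rho> \<le> wasserstein1 \<mu> \<nu> + wasserstein1 \<nu> \<rho>"
    by (simp only: w \<mu> \<nu> \<rho>)
qed

section \<open>Exponential equivalence\<close>

text \<open>Replaces logarithms by exponential bounds on the probabilities themselves, so that union
  bounds become real arithmetic and the value -\<infinity> of \<open>log_prob\<close>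
  disappears.\<close>

lemma le_liminf_log_prob_iff:
  assumes p: "\<And>n. 0 \<le> p n"
  shows "L \<le> liminf (\<lambda>n. ereal (1 / real n) * log_prob (p n)) \<longleftrightarrow>
    (\<forall>c. ereal c < L \<longrightarrow> (\<forall>\<^sub>F n in sequentially. exp (real n * c) \<le> p n))"
proof -
  \<comment> \<open>At n = 0 the factor \<open>1 / real n\<close> is 0 and the equivalence may
    fail.\<close>
  have key: "ereal c \<le> ereal (1 / real n) * log_prob (p n) \<longleftrightarrow> exp (real n * c) \<le> p n" if "n > 0" for c n
  proof (cases "p n = 0")
    case False
    then have "0 < p n" using p[of n] by simp
    then have "exp (real n * c) \<le> p n \<longleftrightarrow> real n * c \<le> ln (p n)" by (rule ln_ge_iff[symmetric])
    then show ?thesis using that False by (simp add: log_prob_def field_simps)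
  qed (use that in \<open>simp add: log_prob_def not_le\<close>)
  show ?thesis
  proof
    assume L: "L \<le> liminf (\<lambda>n. ereal (1 / real n) * log_prob (p n))"
    show "\<forall>c. ereal c < L \<longrightarrow> (\<forall>\<^sub>F n in sequentially. exp (real n * c) \<le> p n)"
    proof (intro allI impI)
      fix c assume "ereal c < L"
      then have "\<forall>\<^sub>F n in sequentially. ereal c < ereal (1 / real n) * log_prob (p n)"
        using L by (intro less_LiminfD) (rule order.strict_trans2)
      with eventually_gt_at_top[of 0] show "\<forall>\<^sub>F n in sequentially. exp (real n * c) \<le> p n"
        by eventually_elim (simp add: less_imp_le flip: key)
    qed
  next
    assume *: "\<forall>c. ereal c < L \<longrightarrow> (\<forall>\<^sub>F n in sequentially. exp (real n * c) \<le> p n)"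
    show "L \<le> liminf (\<lambda>n. ereal (1 / real n) * log_prob (p n))"
    proof (rule le_Liminf_iff[THEN iffD2], intro allI impI)
      fix y assume "y < L"
      \<comment> \<open>A value strictly in between is automatically finite, even when y or L is
        infinite, and it leaves room for the strict inequality.\<close>
      then obtain z where z: "y < z" "z < L" using dense by blast
      then obtain c where c: "z = ereal c" by (cases z) auto
      with z * have "\<forall>\<^sub>F n in sequentially. exp (real n * c) \<le> p n" by auto
      with eventually_gt_at_top[of 0]
      show "\<forall>\<^sub>F n in sequentially. y < ereal (1 / real n) * log_prob (p n)"
        by eventually_elim (use z c in \<open>auto simp: key[symmetric] intro: order.strict_trans2\<close>)
    qed
  qed
qed

lemma limsup_log_prob_le_iff:
  assumes p: "\<And>n. 0 \<le> p n"
  shows "limsup (\<lambda>n. ereal (1 / real n) * log_prob (p n)) \<le> L \<longleftrightarrow>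
    (\<forall>c. L < ereal c \<longrightarrow> (\<forall>\<^sub>F n in sequentially. p n \<le> exp (real n * c)))"
proof -
  have key: "ereal (1 / real n) * log_prob (p n) \<le> ereal c \<longleftrightarrow> p n \<le> exp (real n * c)" if "n > 0" for c n
  proof (cases "p n = 0")
    case False
    then have "0 < p n" using p[of n] by simp
    then have "p n \<le> exp (real n * c) \<longleftrightarrow> ln (p n) \<le> real n * c"
      by (metis exp_gt_zero ln_exp ln_le_cancel_iff)
    then show ?thesis using that False by (simp add: log_prob_def field_simps)
  qed (use that in \<open>simp add: log_prob_def\<close>)
  show ?thesis
  proof
    assume L: "limsup (\<lambda>n. ereal (1 / real n) * log_prob (p n)) \<le> L"
    show "\<forall>c. L < ereal c \<longrightarrow> (\<forall>\<^sub>F n in sequentially. p n \<le> exp (real n * c))"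
    proof (intro allI impI)
      fix c assume "L < ereal c"
      then have "\<forall>\<^sub>F n in sequentially. ereal (1 / real n) * log_prob (p n) < ereal c"
        using L by (intro Limsup_lessD) (rule order.strict_trans1)
      with eventually_gt_at_top[of 0] show "\<forall>\<^sub>F n in sequentially. p n \<le> exp (real n * c)"
        by eventually_elim (simp add: less_imp_le flip: key)
    qed
  next
    assume *: "\<forall>c. L < ereal c \<longrightarrow> (\<forall>\<^sub>F n in sequentially. p n \<le> exp (real n * c))"
    show "limsup (\<lambda>n. ereal (1 / real n) * log_prob (p n)) \<le> L"
    proof (rule Limsup_le_iff[THEN iffD2], intro allI impI)
      fix y assume "L < y"
      then obtain z where z: "L < z" "z < y" using dense by blast
      then obtain c where c: "z = ereal c" by (cases z) auto
      with z * have "\<forall>\<^sub>F n in sequentially. p n \<le> exp (real n * c)" by auto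
      with eventually_gt_at_top[of 0]
      show "\<forall>\<^sub>F n in sequentially. ereal (1 / real n) * log_prob (p n) < y"
        by eventually_elim (use z c in \<open>auto simp: key[symmetric] intro: order.strict_trans1\<close>)
    qed
  qed
qed

text \<open>Absorbs a union bound into an arbitrarily small loss of rate.\<close>

lemma eventually_exp_add_le:
  fixes a b c :: real
  assumes "a < c" "b < c"
  shows "\<forall>\<^sub>F n in sequentially. exp (real n * a) + exp (real n * b) \<le> exp (real n * c)"
proof -
  have "(\<lambda>n. exp (a - c) ^ n + exp (b - c) ^ n) \<longlonglongrightarrow> 0 + 0"
    using assms by (intro tendsto_add LIMSEQ_power_zero) auto
  then have "\<forall>\<^sub>F n in sequentially. exp (a - c) ^ n + exp (b - c) ^ n < 1"
    by (intro order_tendstoD(2)[of _ 0]) auto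
  then show ?thesis
  proof eventually_elim
    case (elim n)
    have "exp (real n * a) + exp (real n * b) = (exp (a - c) ^ n + exp (b - c) ^ n) * exp (real n * c)"
      by (simp add: exp_diff power_divide distrib_right flip: exp_of_nat_mult)
    also have "\<dots> \<le> 1 * exp (real n * c)" using elim by (intro mult_right_mono) auto
    finally show ?case by simp
  qed
qed

section \<open>Borel sets of a topology and congruence of LDPs\<close>

lemma space_borel_of_topology [simp]: "space (borel_of_topology T) = topspace T"
  unfolding borel_of_topology_def by (rule space_measure_of) (auto dest: openin_subset)

lemma openin_sets_borel_of_topology: "openin T U \<Longrightarrow> U \<in> sets (borel_of_topology T)"
  unfolding borel_of_topology_def by (subst sets_measure_of) (auto dest: openin_subset)

lemma closedin_sets_borel_of_topology:
  assumes "closedin T C"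
  shows "C \<in> sets (borel_of_topology T)"
proof -
  have "C = space (borel_of_topology T) - (topspace T - C)"
    using closedin_subset[OF assms] by auto
  then show ?thesis
    using assms openin_sets_borel_of_topology[of T "topspace T - C"] by (metis closedin_def sets.compl_sets)
qed

lemma rate_function_cong:
  assumes "\<And>x. x \<in> topspace T \<Longrightarrow> I x = J x"
  shows "rate_function T I \<longleftrightarrow> rate_function T J"
proof -
  have "{x \<in> topspace T. I x \<le> ereal a} = {x \<in> topspace T. J x \<le> ereal a}" for a
    using assms by auto
  then show ?thesis using assms by (simp add: rate_function_def)
qed

text \<open>Allows K to replace I^X as a rate, given that the two agree on probability
  measures.\<close>

lemma LDP_cong:
  assumes "\<And>x. x \<in> topspace T \<Longrightarrow> I x = J x"
  shows "LDP M T Y I \<longleftrightarrow> LDP M T Y J"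
proof -
  have "(INF x\<in>T interior_of A. I x) = (INF x\<in>T interior_of A. J x)"
       "(INF x\<in>T closure_of A. I x) = (INF x\<in>T closure_of A. J x)" for A
    using interior_of_subset_topspace[of T A] closure_of_subset_topspace[of T A] assms
    by (intro INF_cong; auto)+
  then show ?thesis
    by (simp add: LDP_def LDP_measures_def rate_function_cong[OF assms])
qed

text \<open>Closeness is an abstract relation \<open>close \<epsilon>\<close>, so that no uniform structure on \<open>T\<close> is needed.\<close>

lemma LDP_exponentially_equivalent:
  fixes T :: "'b topology" and close :: "real \<Rightarrow> 'b \<Rightarrow> 'b \<Rightarrow> bool"
  assumes M: "prob_space M"
    and LDP: "LDP M T Y I" and good: "good_rate_function T I"
    and Z: "\<And>n. n \<ge> 1 \<Longrightarrow> Z n \<in> measurable M (borel_of_topology T)"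
    and mono: "\<And>e e' x y. close e x y \<Longrightarrow> e \<le> e' \<Longrightarrow> close e' x y"
    and nbhd: "\<And>U x. openin T U \<Longrightarrow> x \<in> U \<Longrightarrow>
      \<exists>V e. openin T V \<and> x \<in> V \<and> 0 < e \<and> (\<forall>y\<in>V. \<forall>z\<in>topspace T. close e y z \<longrightarrow> z \<in> U)"
    and D: "\<And>e n. 0 < e \<Longrightarrow> n \<ge> 1 \<Longrightarrow> D e n \<in> sets M"
    and D_close: "\<And>e n \<omega>. 0 < e \<Longrightarrow> n \<ge> 1 \<Longrightarrow> \<omega> \<in> space M - D e n \<Longrightarrow> close e (Y n \<omega>) (Z n \<omega>)"
    and D_small: "\<And>e c. 0 < e \<Longrightarrow> \<forall>\<^sub>F n in sequentially. measure M (D e n) \<le> exp (real n * c)"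
  shows "LDP M T Z I"
proof -
  interpret prob_space M by (rule M)
  have Y: "Y n \<in> measurable M (borel_of_topology T)" if "n \<ge> 1" for n
    using LDP that by (simp add: LDP_def)
  have bounds:
    "- (INF x\<in>T interior_of A. I x)
       \<le> liminf (\<lambda>n. ereal (1 / real n) * log_prob (measure (distr M (borel_of_topology T) (Y n)) A))"
    "limsup (\<lambda>n. ereal (1 / real n) * log_prob (measure (distr M (borel_of_topology T) (Y n)) A))
       \<le> - (INF x\<in>T closure_of A. I x)" if "A \<in> sets (borel_of_topology T)" for A
    using LDP that by (auto simp: LDP_def LDP_measures_def)
  have mY: "measure (distr M (borel_of_topology T) (Y n)) A = measure M (Y n -` A \<inter> space M)"
    and mZ: "measure (distr M (borel_of_topology T) (Z n)) A = measure M (Z n -` A \<inter> space M)"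
    if "n \<ge> 1" "A \<in> sets (borel_of_topology T)" for n A
    using Y[of n] Z[of n] that by (auto simp: measure_distr)
  have topY: "Y n \<omega> \<in> topspace T" "Z n \<omega> \<in> topspace T" if "n \<ge> 1" "\<omega> \<in> space M" for n \<omega>
    using measurable_space[OF Y[of n]] measurable_space[OF Z[of n]] that by auto
  have lower: "- (INF x\<in>T interior_of A. I x)
       \<le> liminf (\<lambda>n. ereal (1 / real n) * log_prob (measure (distr M (borel_of_topology T) (Z n)) A))"
    if A: "A \<in> sets (borel_of_topology T)" for A
  proof -
    \<comment> \<open>Lower bound at one point x: Y hits a neighbourhood V of x at exponential cost
      at most \<open>I x\<close>, and outside the superexponentially rare \<open>D e n\<close> this
      puts Z into A. The gap between c and c' pays for the union bound.\<close>
    have "- I x \<le> liminf (\<lambda>n. ereal (1 / real n) * log_prob (measure (distr M (borel_of_topology T) (Z n)) A))"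
      if x: "x \<in> T interior_of A" for x
    proof (rule le_liminf_log_prob_iff[THEN iffD2], simp, intro allI impI)
      fix c assume c: "ereal c < - I x"
      then obtain c' where c': "ereal c < ereal c'" "ereal c' < - I x"
        using ereal_dense2 by blast
      obtain V e where V: "openin T V" "x \<in> V" "0 < e"
        "\<And>y z. y \<in> V \<Longrightarrow> z \<in> topspace T \<Longrightarrow> close e y z \<Longrightarrow> z \<in> T interior_of A"
        using nbhd[OF openin_interior_of x] by blast
      have Vs: "V \<in> sets (borel_of_topology T)" using V by (intro openin_sets_borel_of_topology)
      have "- I x \<le> - (INF x\<in>T interior_of V. I x)"
        using V by (simp add: interior_of_openin INF_lower)
      also have "\<dots> \<le> liminf (\<lambda>n. ereal (1 / real n) * log_prob (measure (distr M (borel_of_topology T) (Y n)) V))"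
        by (rule bounds(1)[OF Vs])
      finally have "\<forall>\<^sub>F n in sequentially. exp (real n * c') \<le> measure (distr M (borel_of_topology T) (Y n)) V"
        using c' by (subst (asm) le_liminf_log_prob_iff) auto
      moreover have "\<forall>\<^sub>F n in sequentially. exp (real n * c) + exp (real n * c) \<le> exp (real n * c')"
        using c' by (intro eventually_exp_add_le) auto
      ultimately show "\<forall>\<^sub>F n in sequentially. exp (real n * c) \<le> measure (distr M (borel_of_topology T) (Z n)) A"
        using D_small[OF V(3), of c] eventually_ge_at_top[of 1]
      proof eventually_elim
        case (elim n)
        have "Y n -` V \<inter> space M \<subseteq> (Z n -` A \<inter> space M) \<union> D e n"
        proof
          fix \<omega> assume \<omega>: "\<omega> \<in> Y n -` V \<inter> space M"
          have "Z n \<omega> \<in> A" if "\<omega> \<notin> D e n"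
            using V(4)[of "Y n \<omega>" "Z n \<omega>"] D_close[OF V(3) elim(4)] topY[OF elim(4)]
              interior_of_subset[of T A] \<omega> that by auto
          with \<omega> show "\<omega> \<in> (Z n -` A \<inter> space M) \<union> D e n" by auto
        qed
        then have "measure M (Y n -` V \<inter> space M) \<le> measure M ((Z n -` A \<inter> space M) \<union> D e n)"
          using measurable_sets[OF Z[OF elim(4)] A] D[OF V(3) elim(4)] by (intro finite_measure_mono) auto
        also have "\<dots> \<le> measure M (Z n -` A \<inter> space M) + measure M (D e n)"
          using measurable_sets[OF Z[OF elim(4)] A] D[OF V(3) elim(4)] by (intro measure_Un_le) auto
        finally show ?case
          using elim(1-3) unfolding mY[OF elim(4) Vs] mZ[OF elim(4) A] by linarith
      qed
    qed
    then show ?thesis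
      by (rule ereal_uminus_le_reorder[THEN iffD2, OF INF_greatest[OF ereal_uminus_le_reorder[THEN iffD1]]])
  qed
  have upper: "limsup (\<lambda>n. ereal (1 / real n) * log_prob (measure (distr M (borel_of_topology T) (Z n)) A))
       \<le> - (INF x\<in>T closure_of A. I x)"
    if A: "A \<in> sets (borel_of_topology T)" for A
  proof (rule limsup_log_prob_le_iff[THEN iffD2], simp, intro allI impI)
    fix c assume c: "- (INF x\<in>T closure_of A. I x) < ereal c"
    then have "ereal (- c) < (INF x\<in>T closure_of A. I x)"
      using ereal_uminus_less_reorder[THEN iffD1, OF c] by simp
    then obtain a where a: "- c < a" "ereal a < (INF x\<in>T closure_of A. I x)"
      using ereal_dense2 by (metis less_ereal.simps(1))
    \<comment> \<open>Goodness enters here: the level set K is compact, and it misses the closure of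
      A because a lies below the infimum of I there.\<close>
    define K where "K = {x \<in> topspace T. I x \<le> ereal a}"
    have K: "compactin T K" using good by (simp add: good_rate_function_def K_def)
    define U where "U = topspace T - T closure_of A"
    have U: "openin T U" by (simp add: U_def closedin_def[symmetric] openin_diff)
    have KU: "K \<subseteq> U"
    proof
      fix x assume x: "x \<in> K"
      have "x \<notin> T closure_of A"
      proof
        assume "x \<in> T closure_of A"
        then have "(INF x\<in>T closure_of A. I x) \<le> I x" by (rule INF_lower)
        with x a(2) show False by (auto simp: K_def dest: order.strict_trans2)
      qed
      with x show "x \<in> U" by (simp add: K_def U_def)
    qed
    have "\<exists>V e. openin T V \<and> x \<in> V \<and> 0 < e \<and> (\<forall>y\<in>V. \<forall>z\<in>topspace T. close e y z \<longrightarrow> z \<in> U)" if "x \<in> K" for x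
      using nbhd[OF U] that KU by blast
    then obtain V e where V: "\<And>x. x \<in> K \<Longrightarrow> openin T (V x)" "\<And>x. x \<in> K \<Longrightarrow> x \<in> V x"
      "\<And>x. x \<in> K \<Longrightarrow> 0 < e x"
      "\<And>x y z. x \<in> K \<Longrightarrow> y \<in> V x \<Longrightarrow> z \<in> topspace T \<Longrightarrow> close (e x) y z \<Longrightarrow> z \<in> U"
      by metis
    \<comment> \<open>A finite subcover leaves finitely many scales, so one common closeness d works
      near all of K.\<close>
    have "\<exists>\<F>. finite \<F> \<and> \<F> \<subseteq> V ` K \<and> K \<subseteq> \<Union>\<F>"
      using K V(1,2) unfolding compactin_def by (elim conjE allE[of _ "V ` K"]) blast
    then obtain S where S: "finite S" "S \<subseteq> K" "K \<subseteq> \<Union> (V ` S)"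
      by (metis finite_subset_image)
    define W where "W = \<Union> (V ` S)"
    \<comment> \<open>The inserted 1 keeps \<open>Min\<close> meaningful when S is empty, as it is
      for empty K.\<close>
    define d where "d = Min (insert 1 (e ` S))"
    have d: "0 < d" "\<And>x. x \<in> S \<Longrightarrow> d \<le> e x"
      using S V(3) by (auto simp: d_def)
    have W: "openin T W" using S V(1) by (auto simp: W_def)
    have W_close: "z \<in> U" if "y \<in> W" "z \<in> topspace T" "close d y z" for y z
    proof -
      obtain x where x: "x \<in> S" "y \<in> V x" using \<open>y \<in> W\<close> by (auto simp: W_def)
      then show ?thesis using V(4)[of x y z] S(2) mono[OF that(3) d(2)[OF x(1)]] that(2) by blast
    qed
    \<comment> \<open>If Z is in A and close to Y, then Y avoids W. On the closed complement of W
      the rate is at least a, since W covers K.\<close>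
    let ?C = "topspace T - W"
    have C: "closedin T ?C" using W by blast
    then have Cs: "?C \<in> sets (borel_of_topology T)" by (rule closedin_sets_borel_of_topology)
    obtain c' where c': "- a < c'" "c' < c" using a(1) dense[of "- a" c] by auto
    have "ereal a \<le> (INF x\<in>T closure_of ?C. I x)"
      unfolding closure_of_closedin[OF C]
    proof (rule INF_greatest)
      fix x assume "x \<in> ?C"
      then have "x \<in> topspace T" "x \<notin> K" using S(3) by (auto simp: W_def)
      then show "ereal a \<le> I x" by (simp add: K_def)
    qed
    then have "- (INF x\<in>T closure_of ?C. I x) \<le> ereal (- a)"
      by (simp flip: uminus_ereal.simps(1))
    also have "\<dots> < ereal c'" using c' by simp
    finally have "\<forall>\<^sub>F n in sequentially. measure (distr M (borel_of_topology T) (Y n)) ?C \<le> exp (real n * c')"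
      using bounds(2)[OF Cs] by (subst (asm) limsup_log_prob_le_iff) auto
    moreover have "\<forall>\<^sub>F n in sequentially. exp (real n * c') + exp (real n * c') \<le> exp (real n * c)"
      using c' by (intro eventually_exp_add_le) auto
    ultimately show "\<forall>\<^sub>F n in sequentially. measure (distr M (borel_of_topology T) (Z n)) A \<le> exp (real n * c)"
      using D_small[OF d(1), of c'] eventually_ge_at_top[of 1]
    proof eventually_elim
      case (elim n)
      have "A \<subseteq> T closure_of A"
        using sets.sets_into_space[OF A] by (intro closure_of_subset) simp
      then have "Z n -` A \<inter> space M \<subseteq> (Y n -` ?C \<inter> space M) \<union> D d n"
        using W_close[OF _ _ D_close[OF d(1) elim(4)]] topY[OF elim(4)] by (auto simp: U_def)
      then have "measure M (Z n -` A \<inter> space M) \<le> measure M ((Y n -` ?C \<inter> space M) \<union> D d n)"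
        using measurable_sets[OF Y[OF elim(4)] Cs] D[OF d(1) elim(4)] by (intro finite_measure_mono) auto
      also have "\<dots> \<le> measure M (Y n -` ?C \<inter> space M) + measure M (D d n)"
        using measurable_sets[OF Y[OF elim(4)] Cs] D[OF d(1) elim(4)] by (intro measure_Un_le) auto
      finally show ?case
        using elim(1-3) unfolding mY[OF elim(4) Cs] mZ[OF elim(4) A] by linarith
    qed
  qed
  show ?thesis
    using LDP Z lower upper by (auto simp: LDP_def LDP_measures_def)
qed

section \<open>The weak topology\<close>

abbreviation bounded_continuous :: "('a::topological_space \<Rightarrow> real) \<Rightarrow> bool" where
  "bounded_continuous f \<equiv> continuous_on UNIV f \<and> bounded (range f)"

lemma openin_weak_topology_induct [consumes 1, case_names empty Int Union basis]:
  assumes "openin weak_topology U"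
    and "P {}"
    and "\<And>A B. P A \<Longrightarrow> P B \<Longrightarrow> P (A \<inter> B)"
    and "\<And>K. (\<And>A. A \<in> K \<Longrightarrow> P A) \<Longrightarrow> P (\<Union>K)"
    and "\<And>(f :: 'a::topological_space \<Rightarrow> real) G. bounded_continuous f \<Longrightarrow> open G \<Longrightarrow>
      P {\<mu> \<in> prob_measures borel. integral\<^sup>L \<mu> f \<in> G}"
  shows "P U"
proof -
  have "generate_topology_on {{\<mu> \<in> prob_measures borel. integral\<^sup>L \<mu> f \<in> G} | (f :: 'a \<Rightarrow> real) G.
        bounded_continuous f \<and> open G} U"
    using assms(1) by (simp add: weak_topology_def openin_topology_generated_by_iff conj_assoc)
  then show ?thesis
    by induction (use assms(2-5) in auto)
qed

lemma openin_weak_topology_basis: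
  fixes f :: "'a::topological_space \<Rightarrow> real"
  assumes "bounded_continuous f" "open G"
  shows "openin weak_topology {\<mu> \<in> prob_measures borel. integral\<^sup>L \<mu> f \<in> G}"
  unfolding weak_topology_def openin_topology_generated_by_iff
  using assms by (intro generate_topology_on.Basis) blast

text \<open>A total variation distance tested on continuous functions only. On this scale the effect
  of perturbing the weights is controlled uniformly in the position of the atoms.\<close>

definition tv_close :: "real \<Rightarrow> 'a::topological_space measure \<Rightarrow> 'a measure \<Rightarrow> bool" where
  "tv_close e \<mu> \<nu> \<longleftrightarrow>
     (\<forall>f. continuous_on UNIV f \<longrightarrow> (\<forall>x. \<bar>f x\<bar> \<le> 1) \<longrightarrow> \<bar>integral\<^sup>L \<mu> f - integral\<^sup>L \<nu> f\<bar> \<le> e)"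

lemma tv_close_mono: "tv_close e \<mu> \<nu> \<Longrightarrow> e \<le> e' \<Longrightarrow> tv_close e' \<mu> \<nu>"
  by (force simp: tv_close_def)

lemma tv_closeD:
  assumes "tv_close e \<mu> \<nu>" "continuous_on UNIV f" "\<And>x. \<bar>f x\<bar> \<le> B" "0 < B"
  shows "\<bar>integral\<^sup>L \<mu> f - integral\<^sup>L \<nu> f\<bar> \<le> B * e"
proof -
  have "\<bar>integral\<^sup>L \<mu> (\<lambda>x. f x / B) - integral\<^sup>L \<nu> (\<lambda>x. f x / B)\<bar> \<le> e"
    using assms by (intro assms(1)[unfolded tv_close_def, rule_format])
      (auto intro!: continuous_intros simp: abs_divide)
  also have "\<bar>integral\<^sup>L \<mu> (\<lambda>x. f x / B) - integral\<^sup>L \<nu> (\<lambda>x. f x / B)\<bar> = \<bar>integral\<^sup>L \<mu> f - integral\<^sup>L \<nu> f\<bar> / B"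
    using \<open>0 < B\<close> by (simp flip: diff_divide_distrib)
  finally show ?thesis using \<open>0 < B\<close> by (simp add: field_simps)
qed

text \<open>Induction on how the open set is generated: intersections take the smaller scale, unions
  inherit one from a member. This is the compatibility with closeness that exponential equivalence
  demands of the topology.\<close>

lemma weak_topology_nbhd:
  assumes "openin weak_topology U" "\<mu> \<in> U"
  shows "\<exists>V e. openin weak_topology V \<and> \<mu> \<in> V \<and> 0 < e \<and>
    (\<forall>\<nu>\<in>V. \<forall>\<nu>'\<in>topspace weak_topology. tv_close e \<nu> \<nu>' \<longrightarrow> \<nu>' \<in> U)"
  using assms
proof (induction arbitrary: \<mu> rule: openin_weak_topology_induct)
  case (Int A B)
  obtain V e where V: "openin weak_topology V" "\<mu> \<in> V" "0 < e"
      "\<And>\<nu> \<nu>'. \<nu> \<in> V \<Longrightarrow> \<nu>' \<in> topspace weak_topology \<Longrightarrow> tv_close e \<nu> \<nu>' \<Longrightarrow> \<nu>' \<in> A"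
    using Int.IH(1)[of \<mu>] Int.prems by auto
  obtain V' e' where V': "openin weak_topology V'" "\<mu> \<in> V'" "0 < e'"
      "\<And>\<nu> \<nu>'. \<nu> \<in> V' \<Longrightarrow> \<nu>' \<in> topspace weak_topology \<Longrightarrow> tv_close e' \<nu> \<nu>' \<Longrightarrow> \<nu>' \<in> B"
    using Int.IH(2)[of \<mu>] Int.prems by auto
  have "\<nu>' \<in> A \<inter> B" if "\<nu> \<in> V \<inter> V'" "\<nu>' \<in> topspace weak_topology" "tv_close (min e e') \<nu> \<nu>'" for \<nu> \<nu>'
    using V(4)[of \<nu> \<nu>'] V'(4)[of \<nu> \<nu>'] that tv_close_mono[OF that(3)] by simp
  then show ?case
    using V(1-3) V'(1-3) by (intro exI[of _ "V \<inter> V'"] exI[of _ "min e e'"]) (simp add: openin_Int)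
next
  case (Union K)
  then obtain A where A: "A \<in> K" "\<mu> \<in> A" by auto
  from Union.IH[OF this] obtain V e where "openin weak_topology V" "\<mu> \<in> V" "0 < e"
      "\<forall>\<nu>\<in>V. \<forall>\<nu>'\<in>topspace weak_topology. tv_close e \<nu> \<nu>' \<longrightarrow> \<nu>' \<in> A"
    by (elim exE conjE)
  with A show ?case by (intro exI[of _ V] exI[of _ e]) auto
next
  case (basis f G)
  then obtain d where d: "0 < d" "ball (integral\<^sup>L \<mu> f) d \<subseteq> G"
    by (auto simp: open_contains_ball)
  obtain B where B: "0 < B" "\<And>x. \<bar>f x\<bar> \<le> B"
    using basis(1) by (auto simp: bounded_pos)
  \<comment> \<open>The set V spends d / 2 of the radius, and closeness at scale
    \<open>d / (4 * B)\<close> spends d / 4, which stays below d.\<close>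
  have "integral\<^sup>L \<nu>' f \<in> G"
    if "integral\<^sup>L \<nu> f \<in> ball (integral\<^sup>L \<mu> f) (d / 2)" "tv_close (d / (4 * B)) \<nu> \<nu>'" for \<nu> \<nu>'
  proof -
    have "\<bar>integral\<^sup>L \<nu> f - integral\<^sup>L \<nu>' f\<bar> \<le> B * (d / (4 * B))"
      using that(2) basis(1) B by (intro tv_closeD) auto
    also have "\<dots> = d / 4" using B by simp
    finally have "integral\<^sup>L \<nu>' f \<in> ball (integral\<^sup>L \<mu> f) d"
      using that(1) d(1) unfolding mem_ball dist_real_def by linarith
    then show ?thesis using d by blast
  qed
  then show ?case
    using basis d B openin_weak_topology_basis[OF basis(1) open_ball, of "integral\<^sup>L \<mu> f" "d / 2"]
    by (intro exI[of _ "{\<nu> \<in> prob_measures borel. integral\<^sup>L \<nu> f \<in> ball (integral\<^sup>L \<mu> f) (d / 2)}"]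
        exI[of _ "d / (4 * B)"]) (auto simp: topspace_weak_topology)
qed auto

text \<open>The integrals generate the topology, so their convergence is convergence of the
  measures; induction over generated open sets replaces a neighbourhood base.\<close>

lemma eventually_in_weak_nbhd:
  assumes "openin weak_topology U" "\<zeta> \<in> U"
    and "\<forall>\<^sub>F n in F. \<mu> n \<in> prob_measures borel"
    and "\<And>f. bounded_continuous f \<Longrightarrow> ((\<lambda>n. integral\<^sup>L (\<mu> n) f) \<longlongrightarrow> integral\<^sup>L \<zeta> f) F"
  shows "\<forall>\<^sub>F n in F. \<mu> n \<in> U"
  using assms(1,2)
proof (induction rule: openin_weak_topology_induct)
  case (Int A B)
  then show ?case by (auto intro: eventually_conj)
next
  case (Union K)
  then obtain A where "A \<in> K" "\<zeta> \<in> A" by auto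
  with Union.IH[OF this] show ?case by (auto elim: eventually_mono)
next
  case (basis f G)
  then have "\<forall>\<^sub>F n in F. integral\<^sup>L (\<mu> n) f \<in> G"
    using assms(4)[OF basis(1)] by (auto dest: topological_tendstoD)
  with assms(3) show ?case by eventually_elim simp
qed auto

text \<open>Indicators of closed sets are pointwise limits of the continuous functions
  \<open>max 0 (1 - real k * infdist x C)\<close>, and closed sets form an intersection-stable
  generator of the Borel sets.\<close>

lemma prob_measures_eqI:
  fixes \<mu> \<nu> :: "'a::metric_space measure"
  assumes \<mu>: "\<mu> \<in> prob_measures borel" and \<nu>: "\<nu> \<in> prob_measures borel"
    and eq: "\<And>f. bounded_continuous f \<Longrightarrow> integral\<^sup>L \<mu> f = integral\<^sup>L \<nu> f"
  shows "\<mu> = \<nu>"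
proof -
  \<comment> \<open>C has to be nonempty here because \<open>infdist x {}\<close> is 0 by
    convention.\<close>
  have lim: "(\<lambda>k. integral\<^sup>L \<mu> (\<lambda>x. max 0 (1 - real k * infdist x C))) \<longlonglongrightarrow> measure \<mu> C"
    if \<mu>: "\<mu> \<in> prob_measures borel" and C: "closed C" "C \<noteq> {}" for \<mu> :: "'a measure" and C
  proof -
    interpret prob_space \<mu> using \<mu> by (simp add: space_prob_algebra)
    have sb[measurable_cong]: "sets \<mu> = sets borel" using \<mu> by (simp add: space_prob_algebra)
    have "(\<lambda>k. integral\<^sup>L \<mu> (\<lambda>x. max 0 (1 - real k * infdist x C))) \<longlonglongrightarrow> integral\<^sup>L \<mu> (indicator C)"
    proof (rule integral_dominated_convergence[where w="\<lambda>_. 1"])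
      show "AE x in \<mu>. (\<lambda>k. max 0 (1 - real k * infdist x C)) \<longlonglongrightarrow> indicator C x"
      proof (rule AE_I2)
        fix x
        show "(\<lambda>k. max 0 (1 - real k * infdist x C)) \<longlonglongrightarrow> indicator C x"
        proof (cases "x \<in> C")
          case False
          then have pos: "0 < infdist x C"
            using C in_closed_iff_infdist_zero[OF C] infdist_nonneg[of x C] by (simp add: order.order_iff_strict)
          obtain N where "1 / infdist x C < real N" using reals_Archimedean2 by blast
          then have N: "1 < real N * infdist x C" using pos by (simp add: field_simps)
          have "max 0 (1 - real k * infdist x C) = 0" if "k \<ge> N" for k
          proof -
            have "real N * infdist x C \<le> real k * infdist x C"
              using that pos by (intro mult_right_mono) auto
            with N show ?thesis by simp
          qed
          then show ?thesis
            using False by (intro tendsto_eventually) (auto simp: eventually_at_top_linorder)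
        qed simp
      qed
      show "AE x in \<mu>. norm (max 0 (1 - real k * infdist x C)) \<le> 1" for k
        by (intro AE_I2) (simp add: infdist_nonneg)
    next
      show "indicat_real C \<in> borel_measurable \<mu>" "integrable \<mu> (\<lambda>_. 1::real)"
        using C by (auto intro!: borel_measurable_indicator)
      show "(\<lambda>x. max 0 (1 - real k * infdist x C)) \<in> borel_measurable \<mu>" for k
        by (intro borel_measurable_max borel_measurable_diff borel_measurable_times borel_measurable_const)
           (simp add: measurable_cong_sets[OF sb refl] borel_measurable_continuous_onI continuous_on_infdist)
    qed
    then show ?thesis using C \<mu> by (simp add: space_prob_algebra)
  qed
  have bc: "bounded_continuous (\<lambda>x. max 0 (1 - real k * infdist x C))" for k and C :: "'a set"
    by (auto intro!: continuous_intros boundedI[where B=1] simp: infdist_nonneg)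
  have "emeasure \<mu> C = emeasure \<nu> C" if "closed C" for C
  proof (cases "C = {}")
    case False
    have "measure \<mu> C = measure \<nu> C"
      using lim[OF \<mu> that False] lim[OF \<nu> that False] eq[OF bc] by (simp add: LIMSEQ_unique)
    moreover have "finite_measure \<mu>" "finite_measure \<nu>"
      using \<mu> \<nu> by (auto simp: space_prob_algebra prob_space_def)
    ultimately show ?thesis by (simp add: finite_measure.emeasure_eq_measure)
  qed simp
  moreover have "Int_stable {C::'a set. closed C}"
    by (auto simp: Int_stable_def)
  moreover have "emeasure \<mu> UNIV \<noteq> \<infinity>"
    using prob_space.emeasure_space_1[of \<mu>] sets_eq_imp_space_eq[of \<mu> borel] \<mu>
    by (simp add: space_prob_algebra)
  moreover have "sets \<mu> = sigma_sets UNIV {C::'a set. closed C}" "sets \<nu> = sigma_sets UNIV {C::'a set. closed C}"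
    using \<mu> \<nu> by (simp_all add: space_prob_algebra borel_eq_closed)
  ultimately show ?thesis
    by (intro measure_eqI_generator_eq[where \<Omega>=UNIV and E="{C. closed C}" and A="\<lambda>_. UNIV"]) auto
qed

text \<open>Provides closed level sets for the rate function that is 0 at \<zeta> and \<infinity>
  elsewhere. Any other measure is told apart from \<zeta> by a single integral, hence lies in a
  subbasic open set avoiding \<zeta>.\<close>

lemma closedin_weak_topology_singleton:
  fixes \<zeta> :: "'a::metric_space measure"
  assumes \<zeta>: "\<zeta> \<in> prob_measures borel"
  shows "closedin weak_topology {\<zeta>}"
proof -
  have "topspace weak_topology - {\<zeta>} = (\<Union>f\<in>{f. bounded_continuous f}.
      {\<mu> \<in> prob_measures borel. integral\<^sup>L \<mu> f \<in> - {integral\<^sup>L \<zeta> f}})"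
    using prob_measures_eqI[OF _ \<zeta>] by (auto simp: topspace_weak_topology)
  also have "openin weak_topology \<dots>"
    by (rule openin_Union) (auto simp del: Compl_iff intro: openin_weak_topology_basis)
  finally show ?thesis using \<zeta> by (simp add: closedin_def topspace_weak_topology)
qed

section \<open>Weighted empirical measures\<close>

lemma measurable_point_measure:
  assumes "\<And>i. i \<in> A \<Longrightarrow> x i \<in> space N"
  shows "x \<in> measurable (point_measure A p) N"
  using assms by (auto simp: measurable_def space_point_measure sets_point_measure)

lemma weighted_empirical_in_prob_measures:
  assumes "\<And>i. i \<in> {1..n} \<Longrightarrow> x i \<in> space N" "\<And>i. i \<in> {1..n} \<Longrightarrow> 0 \<le> w i"
    and "(\<Sum>i=1..n. w i) = real n" "n \<ge> 1"
  shows "weighted_empirical N n w x \<in> prob_measures N"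
proof -
  have "emeasure (weighted_empirical N n w x) (space N) = (\<Sum>i=1..n. ennreal (w i / real n))"
    using assms(1) by (subst emeasure_weighted_empirical) (auto intro!: sum.cong simp: indicator_def)
  also have "\<dots> = ennreal (\<Sum>i=1..n. w i / real n)"
    using assms(2) by (intro sum_ennreal) auto
  also have "\<dots> = 1"
    using assms(3,4) by (simp flip: sum_divide_distrib)
  finally have "prob_space (weighted_empirical N n w x)"
    by (intro prob_spaceI) (simp add: weighted_empirical_def)
  then show ?thesis
    by (simp add: space_prob_algebra weighted_empirical_def)
qed

lemma integral_weighted_empirical:
  fixes f :: "'b \<Rightarrow> real"
  assumes "\<And>i. i \<in> {1..n} \<Longrightarrow> x i \<in> space N" "\<And>i. i \<in> {1..n} \<Longrightarrow> 0 \<le> w i"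
    and "f \<in> borel_measurable N"
  shows "integral\<^sup>L (weighted_empirical N n w x) f = (\<Sum>i=1..n. w i / real n * f (x i))"
  unfolding weighted_empirical_def using assms(2)
  by (subst integral_distr[OF measurable_point_measure[OF assms(1)] assms(3)],
      simp, subst lebesgue_integral_point_measure_finite) auto

text \<open>The two measures share their atoms, so against a function bounded by 1 they differ by at
  most the average of |w i - 1|, whatever the points are.\<close>

lemma tv_close_weighted_empirical:
  assumes "\<And>i. i \<in> {1..n} \<Longrightarrow> 0 \<le> w i" "(\<Sum>i=1..n. \<bar>w i - 1\<bar>) / real n \<le> e"
  shows "tv_close e (empirical borel n x) (weighted_empirical borel n w x)"
  unfolding tv_close_def
proof (intro allI impI)
  fix f :: "'a \<Rightarrow> real" assume f: "continuous_on UNIV f" "\<forall>x. \<bar>f x\<bar> \<le> 1"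
  then have "f \<in> borel_measurable borel" by (intro borel_measurable_continuous_onI)
  then have "integral\<^sup>L (empirical borel n x) f - integral\<^sup>L (weighted_empirical borel n w x) f
    = (\<Sum>i=1..n. (1 - w i) / real n * f (x i))"
    using assms(1)
    by (subst (1 2) integral_weighted_empirical) (auto simp: diff_divide_distrib left_diff_distrib sum_subtractf)
  also have "\<bar>\<dots>\<bar> \<le> (\<Sum>i=1..n. \<bar>(1 - w i) / real n * f (x i)\<bar>)"
    by (rule sum_abs)
  also have "\<dots> \<le> (\<Sum>i=1..n. \<bar>w i - 1\<bar> / real n * 1)"
    unfolding abs_mult using f(2) by (intro sum_mono mult_mono) (auto simp: abs_divide abs_minus_commute)
  also have "\<dots> \<le> e" using assms(2) by (simp flip: sum_divide_distrib)
  finally show "\<bar>integral\<^sup>L (empirical borel n x) f - integral\<^sup>L (weighted_empirical borel n w x) f\<bar> \<le> e" .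
qed

text \<open>The weak topology need not be known to be second countable here: a weighted empirical
  measure depends continuously on finitely many weights and points, which live in a second
  countable space.\<close>

lemma measurable_weighted_empirical:
  fixes X :: "nat \<Rightarrow> 'w \<Rightarrow> 'a::second_countable_topology"
  assumes n: "n \<ge> 1"
    and W: "\<And>i. i \<in> {1..n} \<Longrightarrow> W i \<in> borel_measurable M"
    and X: "\<And>i. i \<in> {1..n} \<Longrightarrow> X i \<in> borel_measurable M"
    and nonneg: "\<And>i \<omega>. i \<in> {1..n} \<Longrightarrow> \<omega> \<in> space M \<Longrightarrow> 0 \<le> W i \<omega>"
    and sum: "\<And>\<omega>. \<omega> \<in> space M \<Longrightarrow> (\<Sum>i=1..n. W i \<omega>) = real n"
  shows "(\<lambda>\<omega>. weighted_empirical borel n (\<lambda>i. W i \<omega>) (\<lambda>i. X i \<omega>)) \<in> measurable M (borel_of_topology weak_topology)"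
proof -
  define Z where "Z = (\<lambda>\<omega>. weighted_empirical borel n (\<lambda>i. W i \<omega>) (\<lambda>i. X i \<omega>))"
  \<comment> \<open>Coordinates outside \<open>{1..n}\<close> are frozen at constants, so that V
    maps into full function spaces over \<open>nat\<close>, whose product topology is second
    countable.\<close>
  define V where "V = (\<lambda>\<omega>. (\<lambda>i. if i \<in> {1..n} then W i \<omega> else 0, \<lambda>i. if i \<in> {1..n} then X i \<omega> else undefined))"
  have W': "(\<lambda>\<omega>. if i \<in> {1..n} then W i \<omega> else 0) \<in> borel_measurable M" for i
    using W[of i] by (cases "i \<in> {1..n}") (simp_all only: if_True if_False borel_measurable_const)
  have X': "(\<lambda>\<omega>. if i \<in> {1..n} then X i \<omega> else undefined) \<in> borel_measurable M" for i
    using X[of i] by (cases "i \<in> {1..n}") (simp_all only: if_True if_False borel_measurable_const)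
  have V: "V \<in> borel_measurable M"
    unfolding V_def
    by (intro borel_measurable_Pair measurable_coordinatewise_then_product W' X')
  have Z: "Z \<omega> \<in> prob_measures borel" if "\<omega> \<in> space M" for \<omega>
    unfolding Z_def using that n nonneg sum by (intro weighted_empirical_in_prob_measures) auto
  \<comment> \<open>Openness of G, rather than mere measurability, is carried through the induction
    because generating a topology uses arbitrary unions.\<close>
  have ex: "\<exists>G. open G \<and> Z -` U \<inter> space M = V -` G \<inter> space M" if "openin weak_topology U" for U
    using that
  proof (induction rule: openin_weak_topology_induct)
    case empty
    show ?case by (rule exI[of _ "{}"]) simp
  next
    case (Int A B)
    then obtain G G' where G: "open G" "Z -` A \<inter> space M = V -` G \<inter> space M"
      and G': "open G'" "Z -` B \<inter> space M = V -` G' \<inter> space M"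
      by blast
    have "Z -` (A \<inter> B) \<inter> space M = (Z -` A \<inter> space M) \<inter> (Z -` B \<inter> space M)" by blast
    also have "\<dots> = V -` (G \<inter> G') \<inter> space M" unfolding G(2) G'(2) by blast
    finally show ?case using open_Int[OF G(1) G'(1)] by (intro exI conjI)
  next
    case (Union K)
    then have "\<forall>A\<in>K. \<exists>G. open G \<and> Z -` A \<inter> space M = V -` G \<inter> space M" by blast
    from bchoice[OF this] obtain G where "\<forall>A\<in>K. open (G A) \<and> Z -` A \<inter> space M = V -` G A \<inter> space M" ..
    then have G: "open (G A)" "Z -` A \<inter> space M = V -` G A \<inter> space M" if "A \<in> K" for A
      using that by simp_all
    have "Z -` (\<Union>K) \<inter> space M = (\<Union>A\<in>K. Z -` A \<inter> space M)" by blast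
    also have "\<dots> = (\<Union>A\<in>K. V -` G A \<inter> space M)" by (rule SUP_cong[OF refl G(2)])
    also have "\<dots> = V -` (\<Union>(G ` K)) \<inter> space M" by blast
    finally have "Z -` (\<Union>K) \<inter> space M = V -` (\<Union>(G ` K)) \<inter> space M" .
    moreover have "open (\<Union>(G ` K))" using G(1) by (intro open_UN) simp
    ultimately show ?case by (intro exI conjI)
  next
    case (basis f H)
    have f: "f \<in> borel_measurable borel" using basis by (intro borel_measurable_continuous_onI) auto
    define h where "h = (\<lambda>p :: (nat \<Rightarrow> real) \<times> (nat \<Rightarrow> 'a). \<Sum>i=1..n. fst p i / real n * f (snd p i))"
    have w: "continuous_on UNIV (\<lambda>p :: (nat \<Rightarrow> real) \<times> (nat \<Rightarrow> 'a). fst p i)" for i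
      by (rule continuous_on_compose2[OF continuous_on_product_coordinates continuous_on_fst[OF continuous_on_id]]) auto
    have x: "continuous_on UNIV (\<lambda>p :: (nat \<Rightarrow> real) \<times> (nat \<Rightarrow> 'a). snd p i)" for i
      by (rule continuous_on_compose2[OF continuous_on_product_coordinates continuous_on_snd[OF continuous_on_id]]) auto
    have fx: "continuous_on UNIV (\<lambda>p :: (nat \<Rightarrow> real) \<times> (nat \<Rightarrow> 'a). f (snd p i))" for i
      by (rule continuous_on_compose2[OF conjunct1[OF basis(1)] x]) simp
    have "continuous_on UNIV h"
      unfolding h_def using n
      by (intro continuous_on_sum continuous_on_mult continuous_on_divide w fx continuous_on_const) simp
    then have "open (h -` H)" using basis(2) by (simp add: open_vimage)
    have "integral\<^sup>L (Z \<omega>) f = h (V \<omega>)" if "\<omega> \<in> space M" for \<omega>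
      unfolding Z_def V_def h_def using that nonneg f by (subst integral_weighted_empirical) (auto intro!: sum.cong)
    then have eq: "Z -` {\<mu> \<in> prob_measures borel. integral\<^sup>L \<mu> f \<in> H} \<inter> space M = V -` (h -` H) \<inter> space M"
      using Z by auto
    then show ?case using \<open>open (h -` H)\<close> by (intro exI conjI)
  qed
  have "Z -` U \<inter> space M \<in> sets M" if "openin weak_topology U" for U
  proof -
    from ex[OF that] obtain G where G: "open G" "Z -` U \<inter> space M = V -` G \<inter> space M" by blast
    show ?thesis unfolding G(2) by (rule measurable_sets[OF V borel_open[OF G(1)]])
  qed
  note pre = this
  show ?thesis
    unfolding Z_def[symmetric] borel_of_topology_def
  proof (rule measurable_measure_of)
    show "{U. openin weak_topology U} \<subseteq> Pow (topspace weak_topology)"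
      using openin_subset by blast
  qed (use Z pre in \<open>auto simp: topspace_weak_topology\<close>)
qed

section \<open>Deterministic arrays\<close>

text \<open>Each s occurs \<open>m s\<close> times, its share of n rounded down, and the r missing
  places go to s0. Rounding loses at most one place per point, so rounding and filling cost at most
  \<open>card S * B\<close> each, whence the factor 2.\<close>

lemma exists_list_with_frequencies:
  fixes p :: "'b \<Rightarrow> real"
  assumes "finite S" "s0 \<in> S" and p: "\<And>s. s \<in> S \<Longrightarrow> 0 \<le> p s" "(\<Sum>s\<in>S. p s) = 1" and n: "n \<ge> 1"
  obtains xs where "length xs = n"
    and "\<And>f B. (\<And>s. \<bar>f s\<bar> \<le> B) \<Longrightarrow>
      \<bar>sum_list (map f xs) / real n - (\<Sum>s\<in>S. p s * f s)\<bar> \<le> 2 * real (card S) * B / real n"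
proof -
  define m where "m s = nat \<lfloor>real n * p s\<rfloor>" for s
  define r where "r = n - (\<Sum>s\<in>S. m s)"
  obtain L where L: "set L = S" "distinct L" using finite_distinct_list[OF \<open>finite S\<close>] by blast
  have m: "real (m s) \<le> real n * p s" "real n * p s - real (m s) \<le> 1" if "s \<in> S" for s
    using p(1)[OF that] by (auto simp: m_def) linarith+
  have "(\<Sum>s\<in>S. real (m s)) \<le> (\<Sum>s\<in>S. real n * p s)"
    using m(1) by (rule sum_mono)
  also have np: "\<dots> = real n" using p(2) by (simp flip: sum_distrib_left)
  finally have le: "(\<Sum>s\<in>S. m s) \<le> n" by (simp flip: of_nat_sum)
  have r: "real r = (\<Sum>s\<in>S. real n * p s - real (m s))"
    using le np by (simp add: r_def of_nat_diff sum_subtractf)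
  have "real r \<le> (\<Sum>s\<in>S. 1)" unfolding r using m(2) by (rule sum_mono)
  then have rS: "real r \<le> real (card S)" by simp
  define xs where "xs = concat (map (\<lambda>s. replicate (m s) s) L) @ replicate r s0"
  have sum_L: "sum_list (map g L) = (\<Sum>s\<in>S. g s)" for g :: "'b \<Rightarrow> 'c::comm_monoid_add"
    using L by (metis sum_list_distinct_conv_sum_set)
  have "length xs = sum_list (map m L) + r"
    by (simp add: xs_def length_concat comp_def)
  then have "length xs = n" using le by (simp add: sum_L r_def)
  moreover have "\<bar>sum_list (map f xs) / real n - (\<Sum>s\<in>S. p s * f s)\<bar> \<le> 2 * real (card S) * B / real n"
    if B: "\<And>s. \<bar>f s\<bar> \<le> B" for f B
  proof -
    have B0: "0 \<le> B" using B[of s0] by linarith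
    have concat: "sum_list (concat (map (\<lambda>s. replicate (m s) (f s)) L)) = sum_list (map (\<lambda>s. real (m s) * f s) L)" for L
      by (induction L) (simp_all add: sum_list_replicate)
    have "sum_list (map f xs) = sum_list (map (\<lambda>s. real (m s) * f s) L) + real r * f s0"
      by (simp add: xs_def map_concat comp_def concat sum_list_replicate)
    then have "sum_list (map f xs) - real n * (\<Sum>s\<in>S. p s * f s) =
      (\<Sum>s\<in>S. (real (m s) - real n * p s) * f s) + real r * f s0"
      by (simp add: sum_L sum_distrib_left left_diff_distrib sum_subtractf mult.assoc)
    also have "\<bar>\<dots>\<bar> \<le> (\<Sum>s\<in>S. \<bar>(real (m s) - real n * p s) * f s\<bar>) + \<bar>real r * f s0\<bar>"
      by (intro order.trans[OF abs_triangle_ineq] add_mono sum_abs order_refl)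
    also have "\<dots> \<le> (\<Sum>s\<in>S. 1 * B) + real (card S) * B"
      unfolding abs_mult using m B B0 rS by (intro add_mono sum_mono mult_mono) auto
    finally have *: "\<bar>sum_list (map f xs) - real n * (\<Sum>s\<in>S. p s * f s)\<bar> \<le> 2 * real (card S) * B"
      by (simp add: mult.commute)
    have "sum_list (map f xs) / real n - (\<Sum>s\<in>S. p s * f s) =
      (sum_list (map f xs) - real n * (\<Sum>s\<in>S. p s * f s)) / real n"
      using n by (simp add: diff_divide_distrib)
    then show ?thesis using * by (simp add: abs_divide divide_right_mono)
  qed
  ultimately show ?thesis by (rule that)
qed

text \<open>The recursion makes Borel measurability a plain induction. The strict comparison keeps
  the earlier point in a tie, so the choice is unambiguous.\<close>

fun nearest :: "(nat \<Rightarrow> 'a::metric_space) \<Rightarrow> nat \<Rightarrow> 'a \<Rightarrow> 'a" where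
  "nearest d 0 x = d 0"
| "nearest d (Suc k) x = (if dist x (d (Suc k)) < dist x (nearest d k x) then d (Suc k) else nearest d k x)"

lemma nearest_in: "nearest d k x \<in> d ` {..k}"
  by (induction k) auto

lemma dist_nearest_le: "j \<le> k \<Longrightarrow> dist x (nearest d k x) \<le> dist x (d j)"
  by (induction k) (auto simp: le_Suc_eq)

lemma nearest_measurable [measurable]:
  fixes d :: "nat \<Rightarrow> 'a::{metric_space, second_countable_topology}"
  shows "nearest d k \<in> borel_measurable borel"
  by (induction k) simp_all

lemma nearest_tendsto:
  assumes "\<And>U. open U \<Longrightarrow> U \<noteq> {} \<Longrightarrow> \<exists>j. d j \<in> U"
  shows "(\<lambda>k. nearest d k x) \<longlonglongrightarrow> x"
proof (rule metric_LIMSEQ_I)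
  fix e :: real assume "0 < e"
  then obtain j where j: "d j \<in> ball x e" using assms[of "ball x e"] by auto
  have "dist (nearest d k x) x < e" if "k \<ge> j" for k
    using dist_nearest_le[OF that, of x d] j by (simp add: dist_commute)
  then show "\<exists>no. \<forall>n\<ge>no. dist (nearest d n x) x < e" by blast
qed

lemma integral_finite_range:
  fixes f :: "'a::{second_countable_topology, t2_space} \<Rightarrow> real"
  assumes \<zeta>: "\<zeta> \<in> prob_measures borel" and q: "q \<in> borel_measurable borel" and S: "finite S" "range q \<subseteq> S"
  shows "integral\<^sup>L \<zeta> (\<lambda>x. f (q x)) = (\<Sum>s\<in>S. measure \<zeta> (q -` {s}) * f s)"
proof -
  interpret prob_space \<zeta> using \<zeta> by (simp add: space_prob_algebra)
  have sb: "sets \<zeta> = sets borel" using \<zeta> by (simp add: space_prob_algebra)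
  have m: "q -` {s} \<in> sets \<zeta>" for s
    using measurable_sets[OF q, of "{s}"] by (simp add: sb)
  have "f (q x) = (\<Sum>s\<in>S. indicator (q -` {s}) x * f s)" for x
  proof -
    have "(\<Sum>s\<in>S. indicator (q -` {s}) x * f s) = (\<Sum>s\<in>S. if s = q x then f s else 0)"
      by (rule sum.cong) (auto simp: indicator_def)
    then show ?thesis using S by (auto simp: sum.delta)
  qed
  then have "integral\<^sup>L \<zeta> (\<lambda>x. f (q x)) = (\<Sum>s\<in>S. integral\<^sup>L \<zeta> (\<lambda>x. indicator (q -` {s}) x * f s))"
    using m by (simp add: Bochner_Integration.integral_sum integrable_real_indicator less_top[symmetric])
  then show ?thesis using m by simp
qed

text \<open>At stage \<open>n\<close> only about \<open>sqrt n\<close> points of a dense sequence are used, so rounding their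
  frequencies to multiples of \<open>1/n\<close> costs \<open>O(1/sqrt n)\<close>.\<close>

lemma exists_empirical_tendsto:
  fixes \<zeta> :: "'a::polish_space measure"
  assumes \<zeta>: "\<zeta> \<in> prob_measures borel"
  obtains x :: "nat \<Rightarrow> nat \<Rightarrow> 'a" where
    "\<And>f. bounded_continuous f \<Longrightarrow> (\<lambda>n. integral\<^sup>L (empirical borel n (x n)) f) \<longlonglongrightarrow> integral\<^sup>L \<zeta> f"
proof -
  interpret prob_space \<zeta> using \<zeta> by (simp add: space_prob_algebra)
  have sb: "sets \<zeta> = sets borel" using \<zeta> by (simp add: space_prob_algebra)
  have sp: "space \<zeta> = UNIV" using sets_eq_imp_space_eq[OF sb] by simp
  obtain D :: "'a set" where D: "countable D" "\<And>U. open U \<Longrightarrow> U \<noteq> {} \<Longrightarrow> \<exists>y\<in>D. y \<in> U"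
    using countable_dense_setE by blast
  have "D \<noteq> {}" using D(2)[of UNIV] by auto
  define d where "d = from_nat_into D"
  have d: "\<exists>j. d j \<in> U" if "open U" "U \<noteq> {}" for U
    using D(2)[OF that] range_from_nat_into[OF \<open>D \<noteq> {}\<close> D(1)] by (metis d_def imageE)
  define \<kappa> where "\<kappa> n = nat \<lfloor>sqrt (real n)\<rfloor>" for n
  have \<kappa>_lim: "filterlim \<kappa> at_top sequentially"
    unfolding \<kappa>_def
    by (intro filterlim_compose[OF filterlim_nat_sequentially] filterlim_compose[OF filterlim_floor_sequentially]
        filterlim_compose[OF sqrt_at_top] filterlim_real_sequentially)
  let ?S = "\<lambda>n. d ` {..\<kappa> n}"
  let ?p = "\<lambda>n s. measure \<zeta> (nearest d (\<kappa> n) -` {s})"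
  have I: "integral\<^sup>L \<zeta> (\<lambda>x. f (nearest d (\<kappa> n) x)) = (\<Sum>s\<in>?S n. ?p n s * f s)" for f :: "'a \<Rightarrow> real" and n
    using nearest_in by (intro integral_finite_range[OF \<zeta>]) auto
  have "\<exists>x. \<forall>f B. (\<forall>s. \<bar>f s\<bar> \<le> B) \<longrightarrow>
      \<bar>(\<Sum>i=1..n. 1 / real n * f (x i)) - integral\<^sup>L \<zeta> (\<lambda>x. f (nearest d (\<kappa> n) x))\<bar>
        \<le> 2 * real (card (?S n)) * B / real n" if "n \<ge> 1" for n
  proof -
    have sum_one: "(\<Sum>s\<in>?S n. ?p n s) = 1" using I[of "\<lambda>_. 1" n] by (simp add: prob_space)
    show ?thesis
    proof (rule exists_list_with_frequencies[of "?S n" "d 0" "?p n" n])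
      fix xs assume xs: "length xs = n"
        "\<And>f B. (\<And>s. \<bar>f s\<bar> \<le> B) \<Longrightarrow>
          \<bar>sum_list (map f xs) / real n - (\<Sum>s\<in>?S n. ?p n s * f s)\<bar> \<le> 2 * real (card (?S n)) * B / real n"
      \<comment> \<open>List positions start at 0, rows at 1.\<close>
      have "(\<Sum>i=1..n. 1 / real n * f (xs ! (i - 1))) = sum_list (map f xs) / real n" for f :: "'a \<Rightarrow> real"
      proof -
        have "sum_list (map f xs) = (\<Sum>i<n. f (xs ! i))"
          using xs(1) by (simp add: sum_list_sum_nth atLeast0LessThan)
        also have "\<dots> = (\<Sum>i=1..n. f (xs ! (i - 1)))"
          by (rule sum.reindex_bij_witness[of _ "\<lambda>i. i - 1" Suc]) auto
        finally show ?thesis by (simp add: sum_divide_distrib)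
      qed
      then show ?thesis using xs(2) I by (intro exI[of _ "\<lambda>i. xs ! (i - 1)"]) simp
    qed (use that sum_one in auto)
  qed
  then obtain x where x: "\<And>n f B. n \<ge> 1 \<Longrightarrow> (\<And>s. \<bar>f s\<bar> \<le> B) \<Longrightarrow>
      \<bar>(\<Sum>i=1..n. 1 / real n * f (x n i)) - integral\<^sup>L \<zeta> (\<lambda>x. f (nearest d (\<kappa> n) x))\<bar>
        \<le> 2 * real (card (?S n)) * B / real n"
    by metis
  have "(\<lambda>n. integral\<^sup>L (empirical borel n (x n)) f) \<longlonglongrightarrow> integral\<^sup>L \<zeta> f" if f: "bounded_continuous f" for f
  proof -
    have [measurable]: "f \<in> borel_measurable borel" using f by (intro borel_measurable_continuous_onI) auto
    obtain B where B: "0 < B" "\<And>s. \<bar>f s\<bar> \<le> B" using f by (auto simp: bounded_pos)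
    \<comment> \<open>Quantisation error: \<open>nearest d k x\<close> tends to x along a dense
      sequence, and f is continuous and bounded by B.\<close>
    have "(\<lambda>k. integral\<^sup>L \<zeta> (\<lambda>x. f (nearest d k x))) \<longlonglongrightarrow> integral\<^sup>L \<zeta> f"
    proof (rule integral_dominated_convergence[where w="\<lambda>_. B"])
      show "AE x in \<zeta>. (\<lambda>k. f (nearest d k x)) \<longlonglongrightarrow> f x"
        by (intro AE_I2 continuous_on_tendsto_compose[OF conjunct1[OF f] nearest_tendsto[OF d]]) simp_all
    qed (use B in \<open>auto simp: measurable_cong_sets[OF sb refl]\<close>)
    then have lim: "(\<lambda>n. integral\<^sup>L \<zeta> (\<lambda>x. f (nearest d (\<kappa> n) x))) \<longlonglongrightarrow> integral\<^sup>L \<zeta> f"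
      using \<kappa>_lim by (rule filterlim_compose)
    have "(\<lambda>n. integral\<^sup>L (empirical borel n (x n)) f - integral\<^sup>L \<zeta> (\<lambda>x. f (nearest d (\<kappa> n) x))) \<longlonglongrightarrow> 0"
    proof (rule tendsto_rabs_zero_cancel, rule tendsto_sandwich[OF _ _ tendsto_const])
      \<comment> \<open>The constant 4 is the factor 2 of the rounding error times the bound
        \<open>2 * sqrt (real n)\<close> on the number of points used.\<close>
      show "(\<lambda>n. 4 * B * (1 / sqrt (real n))) \<longlonglongrightarrow> 0"
        by (intro tendsto_mult_right_zero tendsto_divide_0[OF tendsto_const] filterlim_at_top_imp_at_infinity
            filterlim_compose[OF sqrt_at_top] filterlim_real_sequentially)
      show "\<forall>\<^sub>F n in sequentially. \<bar>integral\<^sup>L (empirical borel n (x n)) f - integral\<^sup>L \<zeta> (\<lambda>x. f (nearest d (\<kappa> n) x))\<bar>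
          \<le> 4 * B * (1 / sqrt (real n))"
        using eventually_ge_at_top[of 1]
      proof eventually_elim
        case (elim n)
        have s: "1 \<le> sqrt (real n)" using elim by simp
        have "real (card (?S n)) \<le> real (\<kappa> n) + 1"
          using card_image_le[of "{..\<kappa> n}" d] by simp
        also have "real (\<kappa> n) \<le> sqrt (real n)" using s by (simp add: \<kappa>_def)
        finally have c: "real (card (?S n)) \<le> 2 * sqrt (real n)" using s by linarith
        have "\<bar>integral\<^sup>L (empirical borel n (x n)) f - integral\<^sup>L \<zeta> (\<lambda>x. f (nearest d (\<kappa> n) x))\<bar>
            \<le> 2 * real (card (?S n)) * B / real n"
          using x[OF elim B(2)] by (subst integral_weighted_empirical) auto
        also have "\<dots> \<le> 2 * (2 * sqrt (real n)) * B / real n"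
          using c B by (intro divide_right_mono mult_right_mono mult_left_mono) auto
        also have "\<dots> = 4 * B * (sqrt (real n) / real n)" by simp
        also have "sqrt (real n) / real n = 1 / sqrt (real n)"
          using elim by (simp add: field_simps flip: real_sqrt_mult)
        finally show ?case .
      qed
    qed simp
    from tendsto_add[OF this lim] show ?thesis by simp
  qed
  then show ?thesis by (rule that)
qed

text \<open>Events have probability 0 or 1, so the scaled logarithms are 0 or -\<infinity>. If z is
  in the interior of A they are eventually 0, if it is outside the closure they are eventually
  -\<infinity>, and in between both bounds are trivial.\<close>

lemma deterministic_LDP:
  assumes M: "prob_space M"
    and z: "z \<in> topspace T" "closedin T {z}"
    and y: "\<And>n. n \<ge> 1 \<Longrightarrow> y n \<in> topspace T"
    and lim: "\<And>U. openin T U \<Longrightarrow> z \<in> U \<Longrightarrow> \<forall>\<^sub>F n in sequentially. y n \<in> U"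
  defines "I \<equiv> \<lambda>x. if x = z then 0 else (\<infinity> :: ereal)"
  shows "good_rate_function T I" "LDP M T (\<lambda>n \<omega>. y n) I"
proof -
  interpret prob_space M by (rule M)
  have levels: "{x \<in> topspace T. I x \<le> ereal a} = (if 0 \<le> a then {z} else {})" for a
    using z(1) by (auto simp: I_def)
  show "good_rate_function T I"
    unfolding good_rate_function_def rate_function_def levels
    using z by (auto simp: I_def finite_imp_compactin)
  moreover have meas: "(\<lambda>\<omega>. y n) \<in> measurable M (borel_of_topology T)" if "n \<ge> 1" for n
    using y[OF that] by simp
  moreover have P: "measure (distr M (borel_of_topology T) (\<lambda>\<omega>. y n)) A = indicator A (y n)"
    if "n \<ge> 1" "A \<in> sets (borel_of_topology T)" for n A
    using meas[OF that(1)] that(2) prob_space by (subst measure_distr) (auto simp: indicator_def)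
  moreover have "- (INF x\<in>T interior_of A. I x)
       \<le> liminf (\<lambda>n. ereal (1 / real n) * log_prob (measure (distr M (borel_of_topology T) (\<lambda>\<omega>. y n)) A))"
    if A: "A \<in> sets (borel_of_topology T)" for A
  proof (cases "z \<in> T interior_of A")
    case True
    have "\<forall>\<^sub>F n in sequentially. ereal (1 / real n) * log_prob (measure (distr M (borel_of_topology T) (\<lambda>\<omega>. y n)) A) = 0"
      using lim[OF openin_interior_of True] eventually_ge_at_top[of 1]
    proof eventually_elim
      case (elim n)
      then have "y n \<in> A" using interior_of_subset[of T A] by auto
      then show ?case using P[OF elim(2) A] by (simp add: log_prob_def)
    qed
    then have "liminf (\<lambda>n. ereal (1 / real n) * log_prob (measure (distr M (borel_of_topology T) (\<lambda>\<omega>. y n)) A)) = 0"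
      by (subst Liminf_eq[of _ "\<lambda>_. 0"]) (auto simp: Liminf_const)
    moreover have "0 \<le> (INF x\<in>T interior_of A. I x)" by (intro INF_greatest) (simp add: I_def)
    ultimately show ?thesis by simp
  next
    case False
    then have "(INF x\<in>T interior_of A. I x) = \<infinity>"
      unfolding I_def by (intro antisym INF_greatest) auto
    then show ?thesis by simp
  qed
  moreover have "limsup (\<lambda>n. ereal (1 / real n) * log_prob (measure (distr M (borel_of_topology T) (\<lambda>\<omega>. y n)) A))
       \<le> - (INF x\<in>T closure_of A. I x)"
    if A: "A \<in> sets (borel_of_topology T)" for A
  proof (cases "z \<in> T closure_of A")
    case True
    have "limsup (\<lambda>n. ereal (1 / real n) * log_prob (measure (distr M (borel_of_topology T) (\<lambda>\<omega>. y n)) A)) \<le> 0"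
    proof (rule Limsup_bounded)
      show "\<forall>\<^sub>F n in sequentially. ereal (1 / real n) * log_prob (measure (distr M (borel_of_topology T) (\<lambda>\<omega>. y n)) A) \<le> 0"
        using eventually_ge_at_top[of 1]
        by eventually_elim (use A in \<open>auto simp: P log_prob_def indicator_def\<close>)
    qed
    also have "(0 :: ereal) \<le> - (INF x\<in>T closure_of A. I x)"
      using INF_lower[OF True, of I] by (simp add: I_def)
    finally show ?thesis .
  next
    case False
    then have "\<forall>\<^sub>F n in sequentially. y n \<in> topspace T - T closure_of A"
      using z by (intro lim) auto
    then have "\<forall>\<^sub>F n in sequentially. ereal (1 / real n) * log_prob (measure (distr M (borel_of_topology T) (\<lambda>\<omega>. y n)) A) \<le> - \<infinity>"
      using eventually_ge_at_top[of 1]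
    proof eventually_elim
      case (elim n)
      have "A \<subseteq> T closure_of A"
        using sets.sets_into_space[OF A] by (intro closure_of_subset) simp
      with elim have "y n \<notin> A" by auto
      then show ?case using P[OF elim(2) A] elim(2) by (simp add: log_prob_def)
    qed
    from Limsup_bounded[OF this] show ?thesis by simp
  qed
  ultimately show "LDP M T (\<lambda>n \<omega>. y n) I"
    by (auto simp: LDP_def LDP_measures_def good_rate_function_def)
qed

section \<open>Constant arrays\<close>

lemma independent_rvs_const:
  assumes M: "prob_space M" and c: "c \<in> space N" and Y: "Y \<in> measurable M N'"
  shows "independent_rvs M N (\<lambda>\<omega>. c) N' Y"
proof -
  interpret prob_space M by (rule M)
  \<comment> \<open>A constant generates the trivial sigma-algebra, which is independent of
    everything.\<close>
  have const: "A = {} \<or> A = space M" if "A \<in> sets (vimage_algebra (space M) (\<lambda>\<omega>. c) N)" for A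
    using that c by (auto simp: sets_vimage_algebra2 split: if_splits)
  have Y': "sets (vimage_algebra (space M) Y N') \<subseteq> events"
    using Y by (auto simp: sets_vimage_algebra2 measurable_space)
  show ?thesis
    unfolding independent_rvs_def
  proof (rule indep_setI)
    fix A B assume "A \<in> sets (vimage_algebra (space M) (\<lambda>\<omega>. c) N)" "B \<in> sets (vimage_algebra (space M) Y N')"
    then have "A = {} \<or> A = space M" "B \<in> events" using const Y' by auto
    then show "prob (A \<inter> B) = prob A * prob B"
      by (auto simp: prob_space Int_absorb1 sets.sets_into_space)
  qed (use const Y' in auto)
qed

text \<open>A constant array is independent of any weights, so the rate function concentrated at an
  arbitrary \<zeta> becomes available as a test in (i).\<close>

lemma exists_admissible_array:
  fixes \<zeta> :: "'a::polish_space measure" and M :: "'w measure"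
  assumes M: "prob_space M" and W: "triangular_array M Rplus W" and \<zeta>: "\<zeta> \<in> prob_measures borel"
  shows "\<exists>X :: nat \<Rightarrow> nat \<Rightarrow> 'w \<Rightarrow> 'a. admissible_array M W X (\<lambda>\<nu>. if \<nu> = \<zeta> then 0 else \<infinity>)"
proof -
  obtain x :: "nat \<Rightarrow> nat \<Rightarrow> 'a" where x:
    "\<And>f. bounded_continuous f \<Longrightarrow> (\<lambda>n. integral\<^sup>L (empirical borel n (x n)) f) \<longlonglongrightarrow> integral\<^sup>L \<zeta> f"
    using exists_empirical_tendsto[OF \<zeta>] by blast
  have prob: "empirical borel n (x n) \<in> prob_measures borel" if "n \<ge> 1" for n
    using that by (intro weighted_empirical_in_prob_measures) auto
  have lim: "\<forall>\<^sub>F n in sequentially. empirical borel n (x n) \<in> U" if "openin weak_topology U" "\<zeta> \<in> U" for U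
    using that(1,2) _ x
  proof (rule eventually_in_weak_nbhd)
    show "\<forall>\<^sub>F n in sequentially. empirical borel n (x n) \<in> prob_measures borel"
      using eventually_ge_at_top[of 1] by eventually_elim (rule prob)
  qed
  note det = deterministic_LDP[OF M _ closedin_weak_topology_singleton[OF \<zeta>], of "\<lambda>n. empirical borel n (x n)"]
  have "row W n \<in> measurable M (PiM {1..n} (\<lambda>_. Rplus))" if "n \<ge> 1" for n
    using W that by (intro measurable_restrict) (auto simp: triangular_array_def)
  then have "admissible_array M W (\<lambda>n i \<omega>. x n i) (\<lambda>\<nu>. if \<nu> = \<zeta> then 0 else \<infinity>)"
    unfolding admissible_array_def triangular_array_def
    using det prob \<zeta> lim by (auto simp: topspace_weak_topology space_PiM intro!: independent_rvs_const[OF M])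
  then show ?thesis by (rule exI[of _ "\<lambda>n i \<omega>. x n i"])
qed

section \<open>Finite cost of nontrivial weights\<close>

text \<open>The logarithm of the density is at most \<open>ln C\<close>, so the positive part is
  finite, and subtracting the negative part can only lower the value.\<close>

lemma rel_entropy_bounded_density:
  assumes N: "prob_space N" and \<rho>: "prob_space (density N g)"
    and g: "g \<in> borel_measurable N" and C: "\<And>x. g x \<le> ennreal C" "1 \<le> C"
  shows "rel_entropy (density N g) N < \<infinity>"
proof -
  interpret N: prob_space N by (rule N)
  interpret \<rho>: prob_space "density N g" by (rule \<rho>)
  have ac: "absolutely_continuous N (density N g)"
    using g by (rule absolutely_continuousI_density)
  \<comment> \<open>\<open>rel_entropy\<close> refers to the Radon-Nikodym derivative, which agrees
    with g only up to null sets of N.\<close>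
  have "AE x in N. g x = RN_deriv N (density N g) x"
    by (rule N.RN_deriv_unique[OF g refl])
  then have "AE x in density N g. g x = RN_deriv N (density N g) x"
    by (intro absolutely_continuous_AE[OF _ ac]) simp_all
  then have le: "AE x in density N g. ennreal (entropy_density (exp 1) N (density N g) x) \<le> ennreal (ln C)"
  proof eventually_elim
    case (elim x)
    have gC: "enn2real (g x) \<le> C" using C by (intro enn2real_leI) auto
    \<comment> \<open>Where the density is 0, the convention \<open>ln 0 = 0\<close> applies, and
      \<open>1 \<le> C\<close> gives the bound.\<close>
    have "log (exp 1) (enn2real (g x)) \<le> ln C"
    proof (cases "enn2real (g x) = 0")
      case False
      then have "0 < enn2real (g x)" using enn2real_nonneg[of "g x"] by linarith
      then show ?thesis using gC by (simp add: log_def)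
    qed (use C in \<open>simp add: log_def\<close>)
    then show ?case unfolding entropy_density_def comp_def elim[symmetric] by (rule ennreal_leI)
  qed
  have "(\<integral>\<^sup>+x. ennreal (entropy_density (exp 1) N (density N g) x) \<partial>density N g) \<le> (\<integral>\<^sup>+x. ennreal (ln C) \<partial>density N g)"
    using le by (rule nn_integral_mono_AE)
  also have "\<dots> = ennreal (ln C)" using \<rho>.emeasure_space_1 by simp
  finally have "(\<integral>\<^sup>+x. ennreal (entropy_density (exp 1) N (density N g) x) \<partial>density N g) < \<infinity>"
    by (rule order.strict_trans1) simp
  then have "enn2ereal (\<integral>\<^sup>+x. ennreal (entropy_density (exp 1) N (density N g) x) \<partial>density N g) < \<infinity>"
    by (cases "\<integral>\<^sup>+x. ennreal (entropy_density (exp 1) N (density N g) x) \<partial>density N g") (auto simp: enn2ereal_ennreal)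
  moreover have "x - y < \<infinity>" if "x < \<infinity>" "0 \<le> y" for x y :: ereal
    using that by (cases x; cases y) auto
  ultimately show ?thesis
    using ac by (simp add: rel_entropy_def)
qed

lemma mean_one_measures_integral:
  assumes "\<mu> \<in> mean_one_measures"
  shows "integrable \<mu> (\<lambda>x. x)" "integral\<^sup>L \<mu> (\<lambda>x. x) = 1" "AE x in \<mu>. 0 \<le> x"
proof -
  have \<mu>: "\<mu> \<in> prob_measures Rplus" "(\<integral>\<^sup>+x. ennreal x \<partial>\<mu>) = 1"
    using assms by (auto simp: mean_one_measures_def)
  have sp: "space \<mu> = {0..}"
    using sets_eq_imp_space_eq[OF prob_algebraD(2)[OF \<mu>(1)]] by (simp add: space_restrict_space)
  have m: "(\<lambda>x. x) \<in> borel_measurable \<mu>"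
    using id_measurable_Rplus by (simp add: measurable_cong_sets[OF prob_algebraD(2)[OF \<mu>(1)] refl])
  show ae: "AE x in \<mu>. 0 \<le> x" by (rule AE_I2) (simp add: sp)
  show "integrable \<mu> (\<lambda>x. x)"
    using m ae \<mu>(2) by (intro integrableI_nonneg) auto
  show "integral\<^sup>L \<mu> (\<lambda>x. x) = 1"
    using m ae \<mu>(2) by (simp add: integral_eq_nn_integral)
qed

text \<open>If almost surely w \<le> 1, or almost surely w > 1, then w - 1 keeps a sign while
  integrating to 0, so it vanishes almost surely and \<mu> is the Dirac mass at 1.\<close>

lemma mean_one_measures_prob_gt_1:
  assumes \<mu>: "\<mu> \<in> mean_one_measures" and ne: "\<mu> \<noteq> return Rplus 1"
  shows "0 < measure \<mu> {x \<in> space \<mu>. 1 < x}" "measure \<mu> {x \<in> space \<mu>. 1 < x} < 1"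
proof -
  have P: "\<mu> \<in> prob_measures Rplus" using \<mu> by (simp add: mean_one_measures_def)
  interpret prob_space \<mu> using prob_algebraD(1)[OF P] .
  have [measurable]: "(\<lambda>x. x) \<in> borel_measurable \<mu>"
    using id_measurable_Rplus by (simp add: measurable_cong_sets[OF prob_algebraD(2)[OF P] refl])
  note I = mean_one_measures_integral[OF \<mu>]
  have int: "integrable \<mu> (\<lambda>x. x - 1)" "integrable \<mu> (\<lambda>x. 1 - x)"
    "integral\<^sup>L \<mu> (\<lambda>x. x - 1) = 0" "integral\<^sup>L \<mu> (\<lambda>x. 1 - x) = 0"
    using I by (simp_all add: prob_space)
  have ae: "\<not> (AE x in \<mu>. x = 1)"
  proof
    assume "AE x in \<mu>. x = 1"
    then have "distr \<mu> Rplus (\<lambda>x. x) = distr \<mu> Rplus (\<lambda>x. 1)"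
      using prob_algebraD(2)[OF P] by (intro distr_cong_AE measurable_ident_sets measurable_const) auto
    moreover have "distr \<mu> Rplus (\<lambda>x. x) = \<mu>"
      using prob_algebraD(2)[OF P] by (intro distr_id2) simp
    moreover have "distr \<mu> Rplus (\<lambda>x. 1) = return Rplus 1"
      by (intro distr_const) simp
    ultimately show False using ne by simp
  qed
  show "0 < prob {x \<in> space \<mu>. 1 < x}"
  proof (rule ccontr)
    assume "\<not> 0 < prob {x \<in> space \<mu>. 1 < x}"
    then have "AE x in \<mu>. \<not> 1 < x"
      by (subst (asm) zero_less_measure_iff) (auto simp: AE_iff_measurable[OF _ refl] emeasure_eq_measure)
    then have "AE x in \<mu>. 0 \<le> 1 - x" by eventually_elim simp
    then have "AE x in \<mu>. 1 - x = 0"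
      by (rule integral_nonneg_eq_0_iff_AE[THEN iffD1, OF int(2) _ int(4)])
    then show False using ae by auto
  qed
  show "prob {x \<in> space \<mu>. 1 < x} < 1"
  proof (rule ccontr)
    assume "\<not> prob {x \<in> space \<mu>. 1 < x} < 1"
    then have "prob {x \<in> space \<mu>. 1 < x} = 1" using prob_le_1 by (simp add: antisym not_less)
    then have "AE x in \<mu>. x \<in> {x \<in> space \<mu>. 1 < x}" by (rule AE_prob_1)
    then have "AE x in \<mu>. 0 \<le> x - 1" by eventually_elim simp
    then have "AE x in \<mu>. x - 1 = 0"
      by (rule integral_nonneg_eq_0_iff_AE[THEN iffD1, OF int(1) _ int(3)])
    then show False using ae by auto
  qed
qed

text \<open>Colour \<open>w\<close> by \<open>a\<close> if \<open>w > 1\<close> and by \<open>b\<close> otherwise. The joint law has a bounded density with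
  respect to the product of its marginals, and weighting favours the colour \<open>a\<close>.\<close>

lemma calK_less_infinity:
  fixes a b :: "'a::{second_countable_topology, t2_space}"
  assumes ab: "a \<noteq> b" and \<mu>: "\<mu> \<in> mean_one_measures" and ne: "\<mu> \<noteq> return Rplus 1" and IW: "IW \<mu> < \<infinity>"
  shows "\<exists>\<nu>\<in>prob_measures (borel :: 'a measure). \<exists>\<zeta>\<in>prob_measures borel. \<nu> \<noteq> \<zeta> \<and> calK IW \<nu> \<zeta> < \<infinity>"
proof -
  have P: "\<mu> \<in> prob_measures Rplus" using \<mu> by (simp add: mean_one_measures_def)
  note sb = prob_algebraD(2)[OF P]
  interpret prob_space \<mu> using prob_algebraD(1)[OF P] .
  have [measurable_cong]: "sets \<mu> = sets Rplus" by (rule sb)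
  have sp: "space \<mu> = {0..}"
    using sets_eq_imp_space_eq[OF sb] by (simp add: space_restrict_space)
  have id[measurable]: "(\<lambda>x. x) \<in> borel_measurable \<mu>"
    using id_measurable_Rplus by (simp add: measurable_cong_sets[OF sb refl])
  note I = mean_one_measures_integral[OF \<mu>]
  define G where "G = {x \<in> space \<mu>. 1 < x}"
  have G[measurable]: "G \<in> sets \<mu>" unfolding G_def by measurable
  define p where "p = prob G"
  have p: "0 < p" "p < 1" using mean_one_measures_prob_gt_1[OF \<mu> ne] by (auto simp: p_def G_def)
  have eG: "emeasure \<mu> G = ennreal p" "emeasure \<mu> (space \<mu> - G) = ennreal (1 - p)"
    by (simp_all only: p_def emeasure_eq_measure prob_compl[OF G])
  define \<phi> where "\<phi> w = (if 1 < w then a else b)" for w :: real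
  have \<phi>[measurable]: "\<phi> \<in> borel_measurable \<mu>" unfolding \<phi>_def by measurable
  let ?J = "\<lambda>w. (w, \<phi> w)"
  have idR: "(\<lambda>w. w) \<in> measurable \<mu> Rplus" by (rule measurable_ident_sets[OF sb])
  have J[measurable]: "?J \<in> measurable \<mu> (Rplus \<Otimes>\<^sub>M borel)" using idR by measurable
  define \<rho> where "\<rho> = distr \<mu> (Rplus \<Otimes>\<^sub>M borel) ?J"
  have \<rho>P: "prob_space \<rho>" and \<rho>s: "sets \<rho> = sets (Rplus \<Otimes>\<^sub>M borel)"
    using J by (auto simp: \<rho>_def prob_space_distr)
  have m1: "marg1 \<rho> = \<mu>"
    unfolding marg1_def \<rho>_def using sb by (subst distr_distr) (auto simp: comp_def intro!: distr_id2)
  define \<zeta> where "\<zeta> = marg2 \<rho>"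
  have \<zeta>: "\<zeta> = distr \<mu> borel \<phi>"
    unfolding \<zeta>_def marg2_def \<rho>_def by (subst distr_distr) (auto simp: comp_def)
  have \<zeta>P: "\<zeta> \<in> prob_measures borel"
    using \<phi> by (simp add: \<zeta> space_prob_algebra prob_space_distr)
  have "\<rho> \<in> mean_one_joint"
    using \<rho>P \<rho>s \<mu> by (simp add: mean_one_joint_def m1 mean_one_measures_def space_prob_algebra)
  define \<nu> where "\<nu> = weighted_marg \<rho>"
  \<comment> \<open>\<rho> lives on the graph of \<phi>, so \<nu> is the law of the colour under
    \<mu> reweighted by w.\<close>
  have \<nu>A: "emeasure \<nu> A = ennreal (\<integral>w. w * indicator (\<phi> -` A) w \<partial>\<mu>)" if A: "A \<in> sets borel" for A
  proof -
    have [measurable]: "fst \<in> borel_measurable (Rplus \<Otimes>\<^sub>M (borel :: 'a measure))"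
      by (rule measurable_compose[OF measurable_fst id_measurable_Rplus])
    have RA: "{0..} \<times> A \<in> sets (Rplus \<Otimes>\<^sub>M borel)"
      using A by (intro pair_measureI) (auto simp: sets_restrict_space intro!: image_eqI[of _ _ "{0..}"])
    have "emeasure \<nu> A = (\<integral>\<^sup>+z. ennreal (fst z) * indicator ({0..} \<times> A) z \<partial>\<rho>)"
      unfolding \<nu>_def by (subst emeasure_weighted_marg[OF \<rho>s A]) (simp add: case_prod_unfold)
    also have "\<dots> = (\<integral>\<^sup>+w. ennreal w * indicator ({0..} \<times> A) (?J w) \<partial>\<mu>)"
      unfolding \<rho>_def using RA by (subst nn_integral_distr[OF J]) auto
    also have "\<dots> = (\<integral>\<^sup>+w. ennreal (w * indicator (\<phi> -` A) w) \<partial>\<mu>)"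
      by (rule nn_integral_cong) (auto simp: indicator_def sp)
    also have "\<dots> = ennreal (\<integral>w. w * indicator (\<phi> -` A) w \<partial>\<mu>)"
    proof (rule nn_integral_eq_integral)
      have "\<phi> -` A \<inter> space \<mu> \<in> sets \<mu>" using A by measurable
      then have "integrable \<mu> (\<lambda>w. w * indicator (\<phi> -` A \<inter> space \<mu>) w)"
        using I(1) by (rule integrable_real_mult_indicator)
      then show "integrable \<mu> (\<lambda>w. w * indicator (\<phi> -` A) w)"
        by (rule Bochner_Integration.integrable_cong[THEN iffD1, rotated -1]) (auto simp: indicator_def)
    qed (rule AE_I2, simp add: sp)
    finally show ?thesis .
  qed
  have "emeasure \<nu> UNIV = 1" using \<nu>A[of UNIV] I(2) by simp
  then have \<nu>P: "\<nu> \<in> prob_measures borel"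
    by (auto simp: space_prob_algebra \<nu>_def weighted_marg_def intro!: prob_spaceI)
  \<comment> \<open>Equal mass at a would make w - 1 integrate to 0 over G, impossible since w > 1
    there and G has positive mass.\<close>
  have "\<nu> \<noteq> \<zeta>"
  proof
    assume eq: "\<nu> = \<zeta>"
    have \<phi>a: "\<phi> -` {a} \<inter> space \<mu> = G" using ab by (auto simp: \<phi>_def G_def split: if_splits)
    have Gi: "integrable \<mu> (\<lambda>w. w * indicator G w)" "integrable \<mu> (indicat_real G)"
      using I(1) G by (auto intro: integrable_real_mult_indicator simp: less_top[symmetric])
    have "emeasure \<nu> {a} = ennreal (\<integral>w. w * indicator (\<phi> -` {a}) w \<partial>\<mu>)" by (rule \<nu>A) simp
    also have "(\<integral>w. w * indicator (\<phi> -` {a}) w \<partial>\<mu>) = (\<integral>w. w * indicator G w \<partial>\<mu>)"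
      using \<phi>a by (intro Bochner_Integration.integral_cong) (auto simp: indicator_def)
    finally have "ennreal (\<integral>w. w * indicator G w \<partial>\<mu>) = emeasure \<zeta> {a}" by (simp add: eq)
    also have "\<dots> = ennreal p"
      unfolding \<zeta> using \<phi> by (subst emeasure_distr) (auto simp: \<phi>a p_def emeasure_eq_measure)
    finally have "(\<integral>w. w * indicator G w \<partial>\<mu>) = p"
      using p by (subst (asm) ennreal_inj) (auto intro!: integral_nonneg_AE simp: sp AE_I2)
    then have "(\<integral>w. w * indicator G w - indicator G w \<partial>\<mu>) = 0"
      using Gi G by (simp add: p_def)
    moreover have "AE w in \<mu>. 0 \<le> w * indicator G w - indicator G w"
      by (rule AE_I2) (auto simp: G_def indicator_def)
    ultimately have "AE w in \<mu>. w * indicator G w - indicator G w = 0"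
      using Gi by (subst (asm) integral_nonneg_eq_0_iff_AE) auto
    then have "AE w in \<mu>. w \<notin> G"
      by eventually_elim (auto simp: G_def)
    then have "prob G = 0" using G by (simp add: prob_eq_0)
    then show False using p by (simp add: p_def)
  qed
  moreover have "rel_entropy \<rho> (\<mu> \<Otimes>\<^sub>M \<zeta>) < \<infinity>"
  proof -
    interpret Z: prob_space \<zeta> using prob_algebraD(1)[OF \<zeta>P] .
    interpret pair_prob_space \<mu> \<zeta> ..
    have [measurable_cong]: "sets \<zeta> = sets borel" by (simp add: \<zeta>)
    \<comment> \<open>Given its colour, w has law \<mu> conditioned on G or on its complement; the
      factors are the inverse masses of a and b under \<zeta>.\<close>
    define g where "g = (\<lambda>(w :: real, x). if 1 < w then (if x = a then ennreal (1 / p) else 0)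
      else (if x = b then ennreal (1 / (1 - p)) else 0))"
    have fm[measurable]: "fst \<in> borel_measurable (\<mu> \<Otimes>\<^sub>M \<zeta>)" by (rule measurable_compose[OF measurable_fst id])
    have [measurable]: "snd \<in> measurable (\<mu> \<Otimes>\<^sub>M \<zeta>) borel" by measurable
    have [measurable]: "{z \<in> space (\<mu> \<Otimes>\<^sub>M \<zeta>). snd z = c} \<in> sets (\<mu> \<Otimes>\<^sub>M \<zeta>)" for c :: 'a
    proof -
      have "snd -` {c} \<inter> space (\<mu> \<Otimes>\<^sub>M \<zeta>) \<in> sets (\<mu> \<Otimes>\<^sub>M \<zeta>)" by (rule measurable_sets[of _ _ borel]) auto
      then show ?thesis by (simp add: vimage_def Int_def conj_commute)
    qed
    have g[measurable]: "g \<in> borel_measurable (\<mu> \<Otimes>\<^sub>M \<zeta>)"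
      unfolding g_def case_prod_unfold by (intro measurable_If) measurable
    have "density (\<mu> \<Otimes>\<^sub>M \<zeta>) g = \<rho>"
    proof (rule measure_eqI)
      show s: "sets (density (\<mu> \<Otimes>\<^sub>M \<zeta>) g) = sets \<rho>"
        by (simp add: \<rho>s sb \<zeta> cong: sets_pair_measure_cong)
      fix A assume "A \<in> sets (density (\<mu> \<Otimes>\<^sub>M \<zeta>) g)"
      then have A[measurable]: "A \<in> sets (\<mu> \<Otimes>\<^sub>M \<zeta>)" by simp
      have A': "A \<in> sets (Rplus \<Otimes>\<^sub>M borel)" using A s \<rho>s by (simp only: sets_density)
      have "emeasure (density (\<mu> \<Otimes>\<^sub>M \<zeta>) g) A = (\<integral>\<^sup>+z. g z * indicator A z \<partial>(\<mu> \<Otimes>\<^sub>M \<zeta>))"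
        by (rule emeasure_density) measurable
      also have "\<dots> = (\<integral>\<^sup>+w. \<integral>\<^sup>+x. g (w, x) * indicator A (w, x) \<partial>\<zeta> \<partial>\<mu>)"
        by (rule Z.nn_integral_fst[symmetric]) measurable
      also have "\<dots> = (\<integral>\<^sup>+w. indicator A (?J w) \<partial>\<mu>)"
      proof (rule nn_integral_cong)
        fix w assume w: "w \<in> space \<mu>"
        \<comment> \<open>For fixed w the inner integral sees only the colour
          \<open>\<phi> w\<close>; its mass p or 1 - p under \<zeta> cancels the factor in
          g.\<close>
        have "(\<integral>\<^sup>+x. g (w, x) * indicator A (w, x) \<partial>\<zeta>) = (\<integral>\<^sup>+w'. g (w, \<phi> w') * indicator A (w, \<phi> w') \<partial>\<mu>)"
        proof -
          have "(\<lambda>x. g (w, x) * indicator A (w, x)) \<in> borel_measurable \<zeta>" using w by measurable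
          then show ?thesis unfolding \<zeta> by (subst nn_integral_distr[OF \<phi>]) auto
        qed
        also have "\<dots> = indicator A (?J w)"
        proof (cases "1 < w")
          case True
          have "(\<integral>\<^sup>+w'. g (w, \<phi> w') * indicator A (w, \<phi> w') \<partial>\<mu>) =
            (\<integral>\<^sup>+w'. (ennreal (1 / p) * indicator A (?J w)) * indicator G w' \<partial>\<mu>)"
            using True ab by (intro nn_integral_cong) (auto simp: g_def \<phi>_def G_def indicator_def)
          also have "\<dots> = (ennreal (1 / p) * ennreal p) * indicator A (?J w)"
            using G by (subst nn_integral_cmult_indicator) (simp_all add: eG mult_ac)
          also have "ennreal (1 / p) * ennreal p = 1" using p by (simp flip: ennreal_mult')
          finally show ?thesis by simp
        next
          case False
          have "(\<integral>\<^sup>+w'. g (w, \<phi> w') * indicator A (w, \<phi> w') \<partial>\<mu>) =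
            (\<integral>\<^sup>+w'. (ennreal (1 / (1 - p)) * indicator A (?J w)) * indicator (space \<mu> - G) w' \<partial>\<mu>)"
            using False ab by (intro nn_integral_cong) (auto simp: g_def \<phi>_def G_def indicator_def)
          also have "\<dots> = (ennreal (1 / (1 - p)) * ennreal (1 - p)) * indicator A (?J w)"
            using G by (subst nn_integral_cmult_indicator) (simp_all add: eG mult_ac)
          also have "ennreal (1 / (1 - p)) * ennreal (1 - p) = 1" using p by (simp flip: ennreal_mult')
          finally show ?thesis by simp
        qed
        finally show "(\<integral>\<^sup>+x. g (w, x) * indicator A (w, x) \<partial>\<zeta>) = indicator A (?J w)" .
      qed
      also have "\<dots> = (\<integral>\<^sup>+z. indicator A z \<partial>\<rho>)"
        unfolding \<rho>_def using A' by (subst nn_integral_distr[OF J]) auto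
      also have "\<dots> = emeasure \<rho> A" using A' \<rho>s by simp
      finally show "emeasure (density (\<mu> \<Otimes>\<^sub>M \<zeta>) g) A = emeasure \<rho> A" .
    qed
    moreover have "rel_entropy (density (\<mu> \<Otimes>\<^sub>M \<zeta>) g) (\<mu> \<Otimes>\<^sub>M \<zeta>) < \<infinity>"
    proof (rule rel_entropy_bounded_density)
      show "prob_space (\<mu> \<Otimes>\<^sub>M \<zeta>)" by (rule P.prob_space_axioms)
      show "prob_space (density (\<mu> \<Otimes>\<^sub>M \<zeta>) g)" unfolding \<open>density (\<mu> \<Otimes>\<^sub>M \<zeta>) g = \<rho>\<close> by (rule \<rho>P)
      \<comment> \<open>The sum dominates both nonzero values of g and is at least 1.\<close>
      show "g z \<le> ennreal (1 / p + 1 / (1 - p))" for z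
        using p by (cases z) (auto simp: g_def intro!: ennreal_leI)
      have "1 \<le> 1 / p" "0 \<le> 1 / (1 - p)" using p by auto
      then show "1 \<le> 1 / p + 1 / (1 - p)" by linarith
    qed (rule g)
    ultimately show ?thesis by simp
  qed
  then have "rel_entropy \<rho> (marg1 \<rho> \<Otimes>\<^sub>M \<zeta>) + IW (marg1 \<rho>) < \<infinity>"
    using IW by (simp add: m1)
  then have "calK IW \<nu> \<zeta> < \<infinity>"
    unfolding calK_def
    using \<open>\<rho> \<in> mean_one_joint\<close> \<zeta>_def \<nu>_def by (intro order.strict_trans1[OF Inf_lower]) blast+
  ultimately show ?thesis using \<nu>P \<zeta>P by blast
qed

section \<open>The equivalence\<close>

lemma return_1_mean_one: "return Rplus 1 \<in> mean_one_measures"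
proof -
  have "(\<integral>\<^sup>+x. ennreal x \<partial>return Rplus 1) = 1"
    using id_measurable_Rplus by (subst nn_integral_return) auto
  then show ?thesis
    by (simp add: mean_one_measures_def space_prob_algebra prob_space_return)
qed

text \<open>A Dirac second marginal leaves a coupling no freedom: its second coordinate is almost
  surely 1, so every coupling has the same cost.\<close>

lemma abs_moment_le_wasserstein1:
  assumes \<mu>: "\<mu> \<in> mean_one_measures"
  shows "(\<integral>\<^sup>+x. ennreal \<bar>x - 1\<bar> \<partial>\<mu>) \<le> ennreal (wasserstein1 \<mu> (return Rplus 1))"
proof -
  let ?I = "INF \<gamma>\<in>couplings \<mu> (return Rplus 1). \<integral>\<^sup>+(x, y). ennreal \<bar>x - y\<bar> \<partial>\<gamma>"
  have P: "\<mu> \<in> prob_measures Rplus" "return Rplus 1 \<in> prob_measures Rplus"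
    using \<mu> return_1_mean_one by (auto simp: mean_one_measures_def)
  have "?I < \<infinity>"
    unfolding INF_couplings_eq[OF P] by (rule nn_integral_quantile_diff_finite[OF \<mu> return_1_mean_one])
  then have "ennreal (wasserstein1 \<mu> (return Rplus 1)) = ?I"
    by (simp add: wasserstein1_def)
  moreover have "(\<integral>\<^sup>+x. ennreal \<bar>x - 1\<bar> \<partial>\<mu>) \<le> ?I"
  proof (rule INF_greatest)
    fix \<gamma> assume \<gamma>: "\<gamma> \<in> couplings \<mu> (return Rplus 1)"
    then have [measurable_cong]: "sets \<gamma> = sets (Rplus \<Otimes>\<^sub>M Rplus)"
      and d: "distr \<gamma> Rplus fst = \<mu>" "distr \<gamma> Rplus snd = return Rplus 1"
      by (auto simp: couplings_def space_prob_algebra)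
    note [measurable] = id_measurable_Rplus
    have pred: "Measurable.pred Rplus (\<lambda>y. y = 1)"
      by (rule measurable_compose[OF id_measurable_Rplus, where g="\<lambda>y. y = 1"]) measurable
    have "AE y in distr \<gamma> Rplus snd. y = 1"
      unfolding d by (subst AE_return[OF _ pred]) simp_all
    then have "AE z in \<gamma>. snd z = 1"
      using AE_distrD[of snd \<gamma> Rplus "\<lambda>y. y = 1"] by simp
    then have "(\<integral>\<^sup>+(x, y). ennreal \<bar>x - y\<bar> \<partial>\<gamma>) = (\<integral>\<^sup>+z. ennreal \<bar>fst z - 1\<bar> \<partial>\<gamma>)"
      by (intro nn_integral_cong_AE) (auto simp: case_prod_unfold)
    also have "\<dots> = (\<integral>\<^sup>+x. ennreal \<bar>x - 1\<bar> \<partial>distr \<gamma> Rplus fst)"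
      by (subst nn_integral_distr) auto
    finally show "(\<integral>\<^sup>+x. ennreal \<bar>x - 1\<bar> \<partial>\<mu>) \<le> (\<integral>\<^sup>+(x, y). ennreal \<bar>x - y\<bar> \<partial>\<gamma>)"
      by (simp add: d)
  qed
  ultimately show ?thesis by simp
qed

lemma abs_moment_empirical_Rplus:
  assumes "\<And>i. i \<in> {1..n} \<Longrightarrow> 0 \<le> w i"
  shows "(\<integral>\<^sup>+x. ennreal \<bar>x - 1\<bar> \<partial>empirical Rplus n w) = ennreal ((\<Sum>i=1..n. \<bar>w i - 1\<bar>) / real n)"
proof -
  have m: "w \<in> measurable (point_measure {1..n} (\<lambda>i. ennreal (1 / real n))) Rplus"
    using assms by (intro measurable_point_measure) auto
  have "(\<integral>\<^sup>+x. ennreal \<bar>x - 1\<bar> \<partial>empirical Rplus n w)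
      = (\<Sum>i=1..n. ennreal (1 / real n) * ennreal \<bar>w i - 1\<bar>)"
    unfolding weighted_empirical_def using id_measurable_Rplus
    by (subst nn_integral_distr[OF m]) (auto simp: nn_integral_point_measure_finite)
  also have "\<dots> = (\<Sum>i=1..n. ennreal (\<bar>w i - 1\<bar> / real n))"
    by (simp flip: ennreal_mult')
  also have "\<dots> = ennreal ((\<Sum>i=1..n. \<bar>w i - 1\<bar>) / real n)"
    by (subst sum_ennreal) (auto simp: sum_divide_distrib)
  finally show ?thesis .
qed

context
  fixes M :: "'w measure" and W :: "nat \<Rightarrow> nat \<Rightarrow> 'w \<Rightarrow> real" and IW :: "real measure \<Rightarrow> ereal"
  assumes M: "prob_space M"
    and tri: "triangular_array M Rplus W"
    and sum_W: "\<And>n \<omega>. n \<ge> 1 \<Longrightarrow> \<omega> \<in> space M \<Longrightarrow> (\<Sum>i=1..n. W n i \<omega>) = real n"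
    and LDP_W: "LDP M wasserstein_topology (\<lambda>n \<omega>. empirical Rplus n (\<lambda>i. W n i \<omega>)) IW"
begin

lemma array_nonneg: "n \<ge> 1 \<Longrightarrow> i \<in> {1..n} \<Longrightarrow> \<omega> \<in> space M \<Longrightarrow> 0 \<le> W n i \<omega>"
  using tri measurable_space[of "W n i" M Rplus \<omega>] by (auto simp: triangular_array_def)

lemma array_borel_measurable: "n \<ge> 1 \<Longrightarrow> i \<in> {1..n} \<Longrightarrow> W n i \<in> borel_measurable M"
  using tri measurable_compose[OF _ id_measurable_Rplus, of "W n i" M] by (auto simp: triangular_array_def)

text \<open>The complement of a ball around the Dirac mass at 1 is closed and carries infinite rate,
  so the LDP upper bound is -\<infinity> there: decay faster than every exponential.\<close>

lemma weights_superexponentially_close: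
  assumes IW: "\<And>\<mu>. \<mu> \<in> mean_one_measures \<Longrightarrow> \<mu> \<noteq> return Rplus 1 \<Longrightarrow> IW \<mu> = \<infinity>"
  obtains D where "\<And>e n. 0 < e \<Longrightarrow> n \<ge> 1 \<Longrightarrow> D e n \<in> sets M"
    and "\<And>e n \<omega>. 0 < e \<Longrightarrow> n \<ge> 1 \<Longrightarrow> \<omega> \<in> space M - D e n \<Longrightarrow> (\<Sum>i=1..n. \<bar>W n i \<omega> - 1\<bar>) / real n \<le> e"
    and "\<And>e c. 0 < e \<Longrightarrow> \<forall>\<^sub>F n in sequentially. measure M (D e n) \<le> exp (real n * c)"
proof -
  interpret prob_space M by (rule M)
  interpret W1: Metric_space mean_one_measures wasserstein1 by (rule Metric_space_wasserstein1)
  let ?T = "wasserstein_topology" and ?Y = "\<lambda>n \<omega>. empirical Rplus n (\<lambda>i. W n i \<omega>)"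
  have T: "?T = W1.mtopology" by (simp add: wasserstein_topology_def)
  define A where "A e = mean_one_measures - W1.mball (return Rplus 1) e" for e
  \<comment> \<open>Openness of balls rests on the metric axioms.\<close>
  have A: "closedin ?T (A e)" for e
    unfolding A_def T by (metis W1.openin_mball W1.topspace_mtopology closedin_diff closedin_topspace)
  have As: "A e \<in> sets (borel_of_topology ?T)" for e
    by (rule closedin_sets_borel_of_topology[OF A])
  have Y: "?Y n \<in> measurable M (borel_of_topology ?T)" if "n \<ge> 1" for n
    using LDP_W that by (simp add: LDP_def)
  have Y_in: "?Y n \<omega> \<in> mean_one_measures" if "n \<ge> 1" "\<omega> \<in> space M" for n \<omega>
    using measurable_space[OF Y] that by (simp add: T)
  define D where "D e n = ?Y n -` A e \<inter> space M" for e n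
  have "D e n \<in> sets M" if "n \<ge> 1" for e n
    unfolding D_def using measurable_sets[OF Y[OF that] As] .
  moreover have "(\<Sum>i=1..n. \<bar>W n i \<omega> - 1\<bar>) / real n \<le> e"
    if "0 < e" "n \<ge> 1" "\<omega> \<in> space M - D e n" for e n \<omega>
  proof -
    have "?Y n \<omega> \<in> W1.mball (return Rplus 1) e"
      using that Y_in[of n \<omega>] by (auto simp: D_def A_def)
    then have "wasserstein1 (?Y n \<omega>) (return Rplus 1) < e"
      by (simp add: W1.commute)
    \<comment> \<open>The mean deviation of the weights is the moment of |x - 1| under their
      empirical measure, which the distance to the Dirac mass bounds.\<close>
    moreover have "ennreal ((\<Sum>i=1..n. \<bar>W n i \<omega> - 1\<bar>) / real n) \<le> ennreal (wasserstein1 (?Y n \<omega>) (return Rplus 1))"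
      using abs_moment_le_wasserstein1[OF Y_in, of n \<omega>] that array_nonneg
        abs_moment_empirical_Rplus[of n "\<lambda>i. W n i \<omega>"] by simp
    ultimately show ?thesis
      using W1.nonneg by (simp add: ennreal_le_iff)
  qed
  moreover have "\<forall>\<^sub>F n in sequentially. measure M (D e n) \<le> exp (real n * c)" if "0 < e" for e c
  proof -
    have "(INF x\<in>?T closure_of A e. IW x) = \<infinity>"
    proof -
      have "IW x = \<infinity>" if "x \<in> A e" for x
        using that \<open>0 < e\<close> return_1_mean_one by (intro IW) (auto simp: A_def)
      then have "\<infinity> \<le> (INF x\<in>A e. IW x)" by (intro INF_greatest) simp
      then show ?thesis by (simp add: closure_of_closedin[OF A])
    qed
    then have "limsup (\<lambda>n. ereal (1 / real n) * log_prob (measure (distr M (borel_of_topology ?T) (?Y n)) (A e))) \<le> - \<infinity>"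
      using LDP_W As[of e] unfolding LDP_def LDP_measures_def by fastforce
    then have "\<forall>\<^sub>F n in sequentially. measure (distr M (borel_of_topology ?T) (?Y n)) (A e) \<le> exp (real n * c)"
      by (subst (asm) limsup_log_prob_le_iff) auto
    with eventually_ge_at_top[of 1] show ?thesis
      by eventually_elim (simp add: D_def measure_distr[OF Y As])
  qed
  ultimately show ?thesis by (rule that)
qed

text \<open>Exponential equivalence with the unweighted empirical measure; the exceptional events
  depend on the weights alone.\<close>

lemma LDP_weighted_empirical:
  fixes X :: "nat \<Rightarrow> nat \<Rightarrow> 'w \<Rightarrow> 'a::polish_space"
  assumes X: "admissible_array M W X IX"
    and calK: "\<And>\<nu> \<zeta> :: 'a measure. \<nu> \<in> prob_measures borel \<Longrightarrow> \<zeta> \<in> prob_measures borel \<Longrightarrow>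
      \<nu> \<noteq> \<zeta> \<Longrightarrow> calK IW \<nu> \<zeta> = \<infinity>"
  shows "LDP M weak_topology (\<lambda>n \<omega>. weighted_empirical borel n (\<lambda>i. W n i \<omega>) (\<lambda>i. X n i \<omega>)) IX"
proof -
  let ?Y = "\<lambda>n \<omega>. empirical borel n (\<lambda>i. X n i \<omega>)"
  let ?Z = "\<lambda>n \<omega>. weighted_empirical borel n (\<lambda>i. W n i \<omega>) (\<lambda>i. X n i \<omega>)"
  have Xm: "X n i \<in> borel_measurable M" if "n \<ge> 1" "i \<in> {1..n}" for n i
    using X that by (simp add: admissible_array_def triangular_array_def)
  have Z: "?Z n \<in> measurable M (borel_of_topology weak_topology)" if "n \<ge> 1" for n
    using that Xm array_borel_measurable array_nonneg sum_W by (intro measurable_weighted_empirical) auto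
  obtain D where D: "\<And>e n. 0 < e \<Longrightarrow> n \<ge> 1 \<Longrightarrow> D e n \<in> sets M"
    "\<And>e n \<omega>. 0 < e \<Longrightarrow> n \<ge> 1 \<Longrightarrow> \<omega> \<in> space M - D e n \<Longrightarrow> tv_close e (?Y n \<omega>) (?Z n \<omega>)"
    "\<And>e c. 0 < e \<Longrightarrow> \<forall>\<^sub>F n in sequentially. measure M (D e n) \<le> exp (real n * c)"
  proof (cases "\<exists>a b :: 'a. a \<noteq> b")
    case True
    then obtain a b :: 'a where ab: "a \<noteq> b" by blast
    \<comment> \<open>A finite value would, by the two-colour construction, produce distinct \<nu>
      and \<zeta> with finite \<open>calK\<close>.\<close>
    have "IW \<mu> = \<infinity>" if "\<mu> \<in> mean_one_measures" "\<mu> \<noteq> return Rplus 1" for \<mu>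
      using calK_less_infinity[OF ab that, of IW] calK by (metis ereal_infty_less(1))
    then show ?thesis
    proof (rule weights_superexponentially_close)
      fix D assume "\<And>e n. 0 < e \<Longrightarrow> n \<ge> 1 \<Longrightarrow> D e n \<in> sets M"
        "\<And>e n \<omega>. 0 < e \<Longrightarrow> n \<ge> 1 \<Longrightarrow> \<omega> \<in> space M - D e n \<Longrightarrow> (\<Sum>i=1..n. \<bar>W n i \<omega> - 1\<bar>) / real n \<le> e"
        "\<And>e c. 0 < e \<Longrightarrow> \<forall>\<^sub>F n in sequentially. measure M (D e n) \<le> exp (real n * c)"
      then show ?thesis
        using array_nonneg by (intro that[of D] tv_close_weighted_empirical) auto
    qed
  next
    case False
    \<comment> \<open>Every f is constant and both measures have mass one, so their integrals agree
      and the exceptional events can be empty.\<close>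
    have "tv_close e (?Y n \<omega>) (?Z n \<omega>)" if "0 < e" "n \<ge> 1" "\<omega> \<in> space M" for e n \<omega>
      unfolding tv_close_def
    proof (intro allI impI)
      fix f :: "'a \<Rightarrow> real"
      have "f = (\<lambda>_. f undefined)" using False by (intro ext) metis
      moreover have "prob_space (?Y n \<omega>)" "prob_space (?Z n \<omega>)"
        using that sum_W array_nonneg weighted_empirical_in_prob_measures[of n "\<lambda>i. X n i \<omega>" borel]
        by (auto simp: space_prob_algebra)
      ultimately have "integral\<^sup>L (?Y n \<omega>) f = f undefined" "integral\<^sup>L (?Z n \<omega>) f = f undefined"
        by (metis prob_space.prob_space lebesgue_integral_const mult_1 real_scaleR_def)+
      then show "\<bar>integral\<^sup>L (?Y n \<omega>) f - integral\<^sup>L (?Z n \<omega>) f\<bar> \<le> e" using that by simp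
    qed
    then show ?thesis by (intro that[of "\<lambda>_ _. {}"]) auto
  qed
  show ?thesis
  proof (rule LDP_exponentially_equivalent[where close=tv_close and D=D])
    show "prob_space M" by (rule M)
    show "LDP M weak_topology ?Y IX" "good_rate_function weak_topology IX"
      using X by (auto simp: admissible_array_def)
  qed (use Z D tv_close_mono weak_topology_nbhd in auto)
qed

end

section \<open>The variational formula in two extreme cases\<close>

lemma rateK_eq:
  assumes calK: "\<And>\<zeta>. \<zeta> \<in> prob_measures borel \<Longrightarrow> calK IW \<nu> \<zeta> = (if \<nu> = \<zeta> then 0 else \<infinity>)"
    and \<nu>: "\<nu> \<in> prob_measures borel"
  shows "rateK IW IX \<nu> = IX \<nu>"
  unfolding rateK_def
proof (rule antisym)
  show "(INF \<zeta>\<in>prob_measures borel. calK IW \<nu> \<zeta> + IX \<zeta>) \<le> IX \<nu>"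
    by (rule INF_lower2[OF \<nu>]) (simp add: calK \<nu>)
  show "IX \<nu> \<le> (INF \<zeta>\<in>prob_measures borel. calK IW \<nu> \<zeta> + IX \<zeta>)"
    by (rule INF_greatest) (simp add: calK)
qed

text \<open>The infinite penalty away from \<zeta> removes every other term of the infimum: in
  \<open>ereal\<close>, adding \<infinity> gives \<infinity> whatever the other summand.\<close>

lemma rateK_point:
  assumes \<zeta>: "\<zeta> \<in> prob_measures borel"
  shows "rateK IW (\<lambda>\<nu>. if \<nu> = \<zeta> then 0 else \<infinity>) \<nu> = calK IW \<nu> \<zeta>"
  unfolding rateK_def
proof (rule antisym)
  show "(INF \<zeta>'\<in>prob_measures borel. calK IW \<nu> \<zeta>' + (if \<zeta>' = \<zeta> then 0 else \<infinity>)) \<le> calK IW \<nu> \<zeta>"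
    by (rule INF_lower2[OF \<zeta>]) simp
  show "calK IW \<nu> \<zeta> \<le> (INF \<zeta>'\<in>prob_measures borel. calK IW \<nu> \<zeta>' + (if \<zeta>' = \<zeta> then 0 else \<infinity>))"
    by (rule INF_greatest) simp
qed

theorem corollary1p3:
  fixes M :: "'w measure"
    and W :: "nat \<Rightarrow> nat \<Rightarrow> 'w \<Rightarrow> real"
    and IW :: "real measure \<Rightarrow> ereal"
  assumes "prob_space M"
    and "triangular_array M Rplus W"
    and "\<And>n \<omega>. n \<ge> 1 \<Longrightarrow> \<omega> \<in> space M \<Longrightarrow> (\<Sum>i=1..n. W n i \<omega>) = real n"
    and "\<And>n. n \<ge> 1 \<Longrightarrow> exchangeable_row M Rplus n (W n)"
    and "good_rate_function wasserstein_topology IW"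
    and "LDP M wasserstein_topology (\<lambda>n \<omega>. empirical Rplus n (\<lambda>i. W n i \<omega>)) IW"
  shows
    "((\<forall>(X :: nat \<Rightarrow> nat \<Rightarrow> 'w \<Rightarrow> 'a::polish_space) IX. admissible_array M W X IX \<longrightarrow>
         (\<forall>\<nu>\<in>prob_measures borel. rateK IW IX \<nu> = IX \<nu>))
      \<longleftrightarrow>
      (\<forall>\<nu>\<in>prob_measures (borel :: 'a measure). \<forall>\<zeta>\<in>prob_measures borel.
         calK IW \<nu> \<zeta> = (if \<nu> = \<zeta> then 0 else \<infinity>)))
     \<and>
     ((\<forall>(X :: nat \<Rightarrow> nat \<Rightarrow> 'w \<Rightarrow> 'a) IX. admissible_array M W X IX \<longrightarrow>
         LDP M weak_topology
           (\<lambda>n \<omega>. weighted_empirical borel n (\<lambda>i. W n i \<omega>) (\<lambda>i. X n i \<omega>)) (rateK IW IX) \<and>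
         (\<forall>\<nu>\<in>prob_measures borel. rateK IW IX \<nu> = IX \<nu>))
      \<longleftrightarrow>
      (\<forall>\<nu>\<in>prob_measures (borel :: 'a measure). \<forall>\<zeta>\<in>prob_measures borel.
         calK IW \<nu> \<zeta> = (if \<nu> = \<zeta> then 0 else \<infinity>)))"
    (is "(?i \<longleftrightarrow> ?ii) \<and> (?i' \<longleftrightarrow> ?ii)")
proof -
  have 1: ?ii if ?i
  proof (intro ballI)
    fix \<nu> \<zeta> :: "'a measure" assume \<nu>: "\<nu> \<in> prob_measures borel" and \<zeta>: "\<zeta> \<in> prob_measures borel"
    obtain X :: "nat \<Rightarrow> nat \<Rightarrow> 'w \<Rightarrow> 'a" where "admissible_array M W X (\<lambda>\<nu>. if \<nu> = \<zeta> then 0 else \<infinity>)"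
      using exists_admissible_array[OF assms(1,2) \<zeta>] by blast
    with that \<nu> have "rateK IW (\<lambda>\<nu>. if \<nu> = \<zeta> then 0 else \<infinity>) \<nu> = (if \<nu> = \<zeta> then 0 else \<infinity>)"
      by blast
    then show "calK IW \<nu> \<zeta> = (if \<nu> = \<zeta> then 0 else \<infinity>)"
      by (simp only: rateK_point[OF \<zeta>])
  qed
  have 2: ?i' if ii: ?ii
  proof (intro allI impI)
    fix X :: "nat \<Rightarrow> nat \<Rightarrow> 'w \<Rightarrow> 'a" and IX assume X: "admissible_array M W X IX"
    have eq: "rateK IW IX \<nu> = IX \<nu>" if "\<nu> \<in> prob_measures borel" for \<nu>
      using ii that by (intro rateK_eq) auto
    have "LDP M weak_topology (\<lambda>n \<omega>. weighted_empirical borel n (\<lambda>i. W n i \<omega>) (\<lambda>i. X n i \<omega>)) IX"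
      using ii by (intro LDP_weighted_empirical[OF assms(1-3,6) X]) auto
    then have "LDP M weak_topology (\<lambda>n \<omega>. weighted_empirical borel n (\<lambda>i. W n i \<omega>) (\<lambda>i. X n i \<omega>)) (rateK IW IX)"
      using eq by (subst LDP_cong[where J=IX]) (simp_all add: topspace_weak_topology)
    with eq show "LDP M weak_topology (\<lambda>n \<omega>. weighted_empirical borel n (\<lambda>i. W n i \<omega>) (\<lambda>i. X n i \<omega>)) (rateK IW IX) \<and>
        (\<forall>\<nu>\<in>prob_measures borel. rateK IW IX \<nu> = IX \<nu>)" by blast
  qed
  \<comment> \<open>\<open>?i'\<close> contains \<open>?i\<close> as its second half, which closes
    the cycle.\<close>
  have 3: ?i if ?i' using that by blast
  show ?thesis using 1 2 3 by blast
qed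

end
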